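(* Let $d\in\mathbb{N}$ and let $Q\in M_d(\mathbb{C})$ be a strictly positive matrix whose list of (distinct) eigenvalues is not of the form $(p,pq,pq^2)$ with $p>0$, $q\in(0,\infty)\setminus\{1\}$. Then there is an isomorphism of complex vector spaces $$H^2(U_Q^+)\cong sl_Q(d),$$ where $sl_Q(d)=\{A\in M_d(\mathbb{C}): AQ=QA,\ \mathrm{Tr}(AQ)=\mathrm{Tr}(AQ^{-1})=0\}$.
   Context: For a strictly positive $Q\in M_d(\mathbb{C})$, $A_u(Q)$ denotes the universal complex unital $^*$-algebra generated by elements $u_{jk}$ ($j,k=1,\dots,d$) such that, with $u=(u_{jk})$, $\bar u=(u_{jk}^* )_{j,k}$ and $u^t=(u_{kj})_{j,k}$, $$uu^*=I=u^*u,\qquad u^tQ\bar uQ^{-1}=I=Q\bar uQ^{-1}u^t .$$ It is the $^*$-algebra associated with the universal unitary quantum group $U_Q^+$. Its distinguished character is $\epsilon:A_u(Q)\to\mathbb{C}$, the unital $^*$-homomorphism with $\epsilon(u_{jk})=\delta_{jk}$. $H^2(U_Q^+):=H^2(A_u(Q),{}_\epsilon\mathbb{C}_\epsilon)$ is the second Hochschild cohomology with trivial coefficients: with $A=A_u(Q)$, $Z^2$ is the space of linear maps $c:A\otimes A\to\mathbb{C}$ with $\epsilon(x)c(y\otimes z)-c(xy\otimes z)+c(x\otimes yz)-c(x\otimes y)\epsilon(z)=0$ for all $x,y,z\in A$; $B^2\subset Z^2$ is the space of maps $\partial\psi$, with $(\partial\psi)(x\otimes y)=\epsilon(x)\psi(y)-\psi(xy)+\psi(x)\epsilon(y)$,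 for $\psi:A\to\mathbb{C}$ linear; and $H^2=Z^2/B^2$. The eigenvalue list of $Q$ means the list of its distinct eigenvalues (without multiplicities), so the excluded case is that $Q$ has exactly three distinct eigenvalues which form a geometric progression. *)

theory Defs
  imports
    "HOL-Analysis.Analysis"
    "HOL-Algebra.QuotRing"
    "HOL-Algebra.Module"
    "HOL-Library.Poly_Mapping"
begin

section \<open>Complex vector spaces and algebras as records\<close>

text \<open>
  Complex vector spaces and (associative, unital, not necessarily commutative) complex algebras
  are values of type \<open>(complex, 'a) module\<close>. For a mere vector space the ring-multiplicative
  fields \<open>mult\<close> and \<open>one\<close> carry no information and are left undefined.
\<close>

definition vs_isomorphic :: "(complex, 'a) module \<Rightarrow> (complex, 'b) module \<Rightarrow> bool" where
  "vs_isomorphic V W \<longleftrightarrow>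
     (\<exists>\<phi> \<in> iso (add_monoid V) (add_monoid W).
        \<forall>a. \<forall>x \<in> carrier V. \<phi> (a \<odot>\<^bsub>V\<^esub> x) = a \<odot>\<^bsub>W\<^esub> \<phi> x)"

text \<open>
  The quotient by a subspace, or (as an algebra) by a two-sided ideal: the library quotient,
  whose elements are the cosets, together with the induced scalar multiplication.
\<close>

definition quot_module :: "(complex, 'a) module \<Rightarrow> 'a set \<Rightarrow> (complex, 'a set) module" where
  "quot_module M N = ring.extend (M Quot N)
     (module.fields (\<lambda>a X. \<Union>x\<in>X. N +>\<^bsub>M\<^esub> (a \<odot>\<^bsub>M\<^esub> x)))"

definition lin_functional :: "(complex, 'a) module \<Rightarrow> ('a \<Rightarrow> complex) \<Rightarrow> bool" where
  "lin_functional V \<psi> \<longleftrightarrow>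
     (\<forall>x \<in> carrier V. \<forall>y \<in> carrier V. \<psi> (x \<oplus>\<^bsub>V\<^esub> y) = \<psi> x + \<psi> y) \<and>
     (\<forall>a. \<forall>x \<in> carrier V. \<psi> (a \<odot>\<^bsub>V\<^esub> x) = a * \<psi> x)"


section \<open>Second Hochschild cohomology with trivial coefficients\<close>

text \<open>
  Linear maps \<open>A \<otimes> A \<rightarrow> \<complex>\<close> are represented by bilinear maps on \<open>A \<times> A\<close>. To have
  exactly one HOL function per map, they are required to vanish off the carrier.
\<close>

definition hochschild_cocycles2 ::
  "(complex, 'a) module \<Rightarrow> ('a \<Rightarrow> complex) \<Rightarrow> ('a \<Rightarrow> 'a \<Rightarrow> complex) set" where
  "hochschild_cocycles2 A \<epsilon> =
     {c. (\<forall>x \<in> carrier A. lin_functional A (\<lambda>y. c x y)) \<and>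
         (\<forall>y \<in> carrier A. lin_functional A (\<lambda>x. c x y)) \<and>
         (\<forall>x y. x \<notin> carrier A \<or> y \<notin> carrier A \<longrightarrow> c x y = 0) \<and>
         (\<forall>x \<in> carrier A. \<forall>y \<in> carrier A. \<forall>z \<in> carrier A.
            \<epsilon> x * c y z - c (x \<otimes>\<^bsub>A\<^esub> y) z + c x (y \<otimes>\<^bsub>A\<^esub> z) - c x y * \<epsilon> z = 0)}"

definition hochschild_d1 ::
  "(complex, 'a) module \<Rightarrow> ('a \<Rightarrow> complex) \<Rightarrow> ('a \<Rightarrow> complex) \<Rightarrow> 'a \<Rightarrow> 'a \<Rightarrow> complex" where
  "hochschild_d1 A \<epsilon> \<psi> = (\<lambda>x y.
     if x \<in> carrier A \<and> y \<in> carrier A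
     then \<epsilon> x * \<psi> y - \<psi> (x \<otimes>\<^bsub>A\<^esub> y) + \<psi> x * \<epsilon> y else 0)"

definition hochschild_coboundaries2 ::
  "(complex, 'a) module \<Rightarrow> ('a \<Rightarrow> complex) \<Rightarrow> ('a \<Rightarrow> 'a \<Rightarrow> complex) set" where
  "hochschild_coboundaries2 A \<epsilon> = {hochschild_d1 A \<epsilon> \<psi> |\<psi>. lin_functional A \<psi>}"

definition hochschild_Z2 ::
  "(complex, 'a) module \<Rightarrow> ('a \<Rightarrow> complex) \<Rightarrow> (complex, 'a \<Rightarrow> 'a \<Rightarrow> complex) module" where
  "hochschild_Z2 A \<epsilon> =
     \<lparr>carrier = hochschild_cocycles2 A \<epsilon>, mult = undefined, one = undefined,
      zero = (\<lambda>x y. 0), add = (\<lambda>c c' x y. c x y + c' x y),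
      smult = (\<lambda>a c x y. a * c x y)\<rparr>"

definition hochschild_H2 ::
  "(complex, 'a) module \<Rightarrow> ('a \<Rightarrow> complex) \<Rightarrow> (complex, ('a \<Rightarrow> 'a \<Rightarrow> complex) set) module" where
  "hochschild_H2 A \<epsilon> = quot_module (hochschild_Z2 A \<epsilon>) (hochschild_coboundaries2 A \<epsilon>)"


section \<open>The free *-algebra on the matrix entries\<close>

text \<open>
  Words form a monoid under concatenation, written additively so that the library's convolution
  product turns the finitely supported functions \<open>'g free_word \<Rightarrow>\<^sub>0 complex\<close> into the free
  unital algebra on \<open>'g\<close>.
\<close>

datatype 'g free_word = Word (letters: "'g list")

instantiation free_word :: (type) monoid_add
begin

definition zero_free_word :: "'a free_word" where
  "0 = Word []"

definition plus_free_word :: "'a free_word \<Rightarrow> 'a free_word \<Rightarrow> 'a free_word" where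
  "v + w = Word (letters v @ letters w)"

instance
  by standard (auto simp: zero_free_word_def plus_free_word_def)

end

text \<open>\<open>U j k\<close> stands for \<open>u\<^sub>j\<^sub>k\<close> and \<open>Ustar j k\<close> for \<open>(u\<^sub>j\<^sub>k)\<^sup>*\<close>.\<close>

datatype 'n gen = U 'n 'n | Ustar 'n 'n

type_synonym 'n free_star_alg = "'n gen free_word \<Rightarrow>\<^sub>0 complex"

definition gen_elem :: "'n gen \<Rightarrow> 'n free_star_alg" where
  "gen_elem g = Poly_Mapping.single (Word [g]) 1"

definition scalar_elem :: "complex \<Rightarrow> 'n free_star_alg" where
  "scalar_elem a = Poly_Mapping.single 0 a"

fun gen_star :: "'n gen \<Rightarrow> 'n gen" where
  "gen_star (U j k) = Ustar j k"
| "gen_star (Ustar j k) = U j k"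

definition word_star :: "'n gen free_word \<Rightarrow> 'n gen free_word" where
  "word_star w = Word (rev (map gen_star (letters w)))"

definition free_star :: "'n free_star_alg \<Rightarrow> 'n free_star_alg" where
  "free_star x =
     (\<Sum>w \<in> Poly_Mapping.keys x. Poly_Mapping.single (word_star w) (cnj (Poly_Mapping.lookup x w)))"

definition free_algebra :: "(complex, 'n free_star_alg) module" where
  "free_algebra =
     \<lparr>carrier = UNIV, mult = (*), one = 1, zero = 0, add = (+),
      smult = (\<lambda>a x. scalar_elem a * x)\<rparr>"

text \<open>The unital homomorphism with \<open>u\<^sub>j\<^sub>k \<mapsto> \<delta>\<^sub>j\<^sub>k\<close> and \<open>(u\<^sub>j\<^sub>k)\<^sup>* \<mapsto> \<delta>\<^sub>j\<^sub>k\<close>.\<close>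

fun gen_counit :: "'n gen \<Rightarrow> complex" where
  "gen_counit (U j k) = (if j = k then 1 else 0)"
| "gen_counit (Ustar j k) = (if j = k then 1 else 0)"

definition free_counit :: "'n free_star_alg \<Rightarrow> complex" where
  "free_counit x =
     (\<Sum>w \<in> Poly_Mapping.keys x. Poly_Mapping.lookup x w * prod_list (map gen_counit (letters w)))"


section \<open>The *-algebra of the universal unitary quantum group\<close>

definition u_mat :: "('n free_star_alg)^'n^'n::finite" where
  "u_mat = (\<chi> j k. gen_elem (U j k))"

definition ubar_mat :: "('n free_star_alg)^'n^'n::finite" where
  "ubar_mat = (\<chi> j k. gen_elem (Ustar j k))"

definition ustar_mat :: "('n free_star_alg)^'n^'n::finite" where
  "ustar_mat = transpose ubar_mat"

definition const_mat :: "complex^'n^'n \<Rightarrow> ('n free_star_alg)^'n^'n::finite" where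
  "const_mat Q = map_matrix scalar_elem Q"

definition Au_relations :: "complex^'n^'n \<Rightarrow> 'n::finite free_star_alg set" where
  "Au_relations Q =
     {(M - mat 1) $ j $ k |M j k.
        M \<in> {u_mat ** ustar_mat,
             ustar_mat ** u_mat,
             transpose u_mat ** const_mat Q ** ubar_mat ** const_mat (matrix_inv Q),
             const_mat Q ** ubar_mat ** const_mat (matrix_inv Q) ** transpose u_mat}}"

text \<open>The two-sided *-ideal generated by the relations (the star is an anti-automorphism, so adjoining
  the adjoints of the generators makes the ideal *-closed).\<close>

definition Au_ideal :: "complex^'n^'n \<Rightarrow> 'n::finite free_star_alg set" where
  "Au_ideal Q = Idl\<^bsub>free_algebra\<^esub> (Au_relations Q \<union> free_star ` Au_relations Q)"

definition Au :: "complex^'n^'n \<Rightarrow> (complex, 'n::finite free_star_alg set) module" where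
  "Au Q = quot_module free_algebra (Au_ideal Q)"

text \<open>
  The character induced on the quotient: the common value of \<^const>\<open>free_counit\<close> on a coset.
  It is meaningful only when \<open>Q\<close> is invertible, since otherwise \<^const>\<open>free_counit\<close>
  need not vanish on the ideal.
\<close>

definition Au_counit :: "'n::finite free_star_alg set \<Rightarrow> complex" where
  "Au_counit X = the_elem (free_counit ` X)"

definition H2_UQ ::
  "complex^'n^'n \<Rightarrow>
     (complex, ('n::finite free_star_alg set \<Rightarrow> 'n free_star_alg set \<Rightarrow> complex) set) module" where
  "H2_UQ Q = hochschild_H2 (Au Q) Au_counit"


section \<open>Matrices\<close>

definition strictly_positive :: "complex^'n^'n::finite \<Rightarrow> bool" where
  "strictly_positive Q \<longleftrightarrow>
     transpose (map_matrix cnj Q) = Q \<and>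
     (\<forall>v. v \<noteq> 0 \<longrightarrow> 0 < Re (\<Sum>i\<in>UNIV. cnj (v $ i) * (Q *v v) $ i))"

definition eigenvalues :: "complex^'n^'n::finite \<Rightarrow> complex set" where
  "eigenvalues Q = {\<mu>. \<exists>v. v \<noteq> 0 \<and> Q *v v = \<mu> *s v}"

definition sl_Q :: "complex^'n^'n::finite \<Rightarrow> (complex, complex^'n^'n) module" where
  "sl_Q Q =
     \<lparr>carrier = {A. A ** Q = Q ** A \<and> trace (A ** Q) = 0 \<and> trace (A ** matrix_inv Q) = 0},
      mult = undefined, one = undefined, zero = 0, add = (+),
      smult = (\<lambda>a A. map_matrix ((*) a) A)\<rparr>"

end

theory Submission
  imports Defs
begin


text \<open>
  Write \<open>A = F / I\<close> for the free algebra \<open>F\<close> on the entries of \<open>u\<close> and of \<open>v\<close>, the entrywise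
  adjoint of \<open>u\<close>, and write \<open>P\<close> for the inverse of \<open>Q\<close>. A cocycle of \<open>A\<close> pulls back to a
  cocycle of \<open>F\<close>, and a free algebra has no second cohomology, so the pullback is the coboundary of a
  functional \<open>\<psi>\<close> on \<open>F\<close>. Since the pullback vanishes as soon as one argument is in \<open>I\<close>, the
  functional is \<^emph>\<open>balanced\<close>: \<open>\<psi> (x r) = \<epsilon> x \<psi> r\<close> and \<open>\<psi> (r x) = \<psi> r \<epsilon> x\<close> for
  \<open>r \<in> I\<close>. It is unique up to a derivation \<open>F \<rightarrow> \<complex>\<close>, and the cocycle is a coboundary iff
  some choice of \<open>\<psi>\<close> vanishes on \<open>I\<close>. This is the analogue of Hopf's formula: the second
  cohomology consists of the balanced functionals on \<open>I\<close> modulo the restrictions of derivations.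

  A balanced functional on \<open>I\<close> is determined by its values on the four matrices of relations. In
  \<open>F\<close> one has \<open>(u u\<^sup>* - 1) u = u (u\<^sup>* u - 1)\<close>, so the first two matrices of values agree, and
  similarly the last two. Hence there are a matrix \<open>B\<close> of values on \<open>u u\<^sup>* - 1\<close> and a matrix
  \<open>C\<close> of values on \<open>u\<^sup>t Q v P - 1\<close>. Subtracting a derivation kills \<open>B\<close> and replaces
  \<open>C\<close> by the obstruction matrix \<open>N = C - Q B\<^sup>t P\<close>. The derivations that remain change \<open>N\<close> by
  the matrices \<open>X - Q X P\<close>; as \<open>Q\<close> is diagonalisable, these form a complement of the commutant of
  \<open>Q\<close>, and so the projection of \<open>N\<close> to the commutant is a complete invariant of the class of the
  cocycle. Two further identities in \<open>F\<close>, namely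
  \<open>tr (u\<^sup>t Q v) = tr (Q\<^sup>t u u\<^sup>*)\<close> and \<open>tr (v P u\<^sup>t) = tr (P\<^sup>t u\<^sup>* u)\<close>, say exactly that
  \<open>tr (N Q) = tr (N P) = 0\<close>. Therefore \<open>H\<^sup>2\<close> embeds into \<open>sl_Q\<close>.

  For surjectivity, balanced functionals come from representations of \<open>F\<close> by upper triangular
  \<open>4 \<times> 4\<close> matrices with \<open>\<epsilon>\<close> at both ends of the diagonal, in which the relations hold except in the
  upper right corner: the corner coefficient is then balanced (\<open>realisable_triangular\<close>). Two families
  suffice. Two derivations give the commutators \<open>[Y, X]\<close> in the commutant
  (\<open>realisable_commutator\<close>). A triangle of matrix units along three distinct eigenvalues, with
  suitable diagonal characters in the two middle places, gives a Massey type product whose corner is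
  diagonal in the eigenbasis (\<open>realisable_distinct\<close>). Its three diagonal entries are, up to a
  factor, the cross product of the triple of eigenvalues and the triple of their inverses. Such
  cross products and the commutators span \<open>sl_Q\<close> (\<open>realisable_traceless\<close>).
\<close>

section \<open>Linear functionals on the free algebra\<close>

lemma free_algebra_simps [simp]:
  "carrier free_algebra = UNIV" "mult free_algebra = (*)" "one free_algebra = 1"
  "zero free_algebra = 0" "add free_algebra = (+)"
  "smult free_algebra = (\<lambda>a x. scalar_elem a * x)"
  by (simp_all add: free_algebra_def)

abbreviation linear_fun :: "('n free_star_alg \<Rightarrow> complex) \<Rightarrow> bool" where
  "linear_fun \<equiv> lin_functional free_algebra"

lemma linear_fun_iff:
  "linear_fun f \<longleftrightarrow> (\<forall>x y. f (x + y) = f x + f y) \<and> (\<forall>a x. f (scalar_elem a * x) = a * f x)"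
  by (simp add: lin_functional_def)

lemma scalar_elem_simps:
  "scalar_elem 0 = 0" "scalar_elem 1 = 1"
  "scalar_elem (a + b) = scalar_elem a + scalar_elem b"
  "scalar_elem (a * b) = scalar_elem a * scalar_elem b"
  "scalar_elem (- a) = - scalar_elem a"
  by (simp_all add: scalar_elem_def single_add mult_single single_uminus)

lemma lookup_scalar_elem_times: "Poly_Mapping.lookup (scalar_elem a * x) w = a * Poly_Mapping.lookup x w"
  unfolding scalar_elem_def mult_map_scale_conv_mult [symmetric]
  by (simp add: map.rep_eq when_def)

lemma poly_mapping_eq_sum_single:
  "x = (\<Sum>w\<in>Poly_Mapping.keys x. Poly_Mapping.single w (Poly_Mapping.lookup x w))"
  by (rule poly_mapping_eqI)
    (simp add: lookup_sum lookup_single when_def in_keys_iff)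

lemma scalar_elem_times_single:
  "scalar_elem a * Poly_Mapping.single w b = Poly_Mapping.single w (a * b)"
  by (simp add: scalar_elem_def mult_single)

lemma single_times_scalar_elem:
  "Poly_Mapping.single w b * scalar_elem a = Poly_Mapping.single w (a * b)"
  by (simp add: scalar_elem_def mult_single mult.commute)

lemma scalar_elem_central: "x * scalar_elem a = scalar_elem a * x"
proof -
  have "(\<Sum>w\<in>Poly_Mapping.keys x. Poly_Mapping.single w (Poly_Mapping.lookup x w)) * scalar_elem a
      = scalar_elem a * (\<Sum>w\<in>Poly_Mapping.keys x. Poly_Mapping.single w (Poly_Mapping.lookup x w))"
    by (simp add: sum_distrib_left sum_distrib_right scalar_elem_times_single single_times_scalar_elem)
  then show ?thesis
    by (simp only: poly_mapping_eq_sum_single [of x, symmetric])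
qed

lemma
  assumes "linear_fun f"
  shows linear_fun_add: "f (x + y) = f x + f y"
    and linear_fun_scale: "f (scalar_elem a * x) = a * f x"
    and linear_fun_scale_right: "f (x * scalar_elem a) = a * f x"
    and linear_fun_zero: "f 0 = 0"
    and linear_fun_minus: "f (- x) = - f x"
    and linear_fun_diff: "f (x - y) = f x - f y"
    and linear_fun_sum: "f (\<Sum>i\<in>A. h i) = (\<Sum>i\<in>A. f (h i))"
proof -
  show add: "f (x + y) = f x + f y" for x y
    using assms by (simp add: linear_fun_iff)
  show scale: "f (scalar_elem a * x) = a * f x" for a x
    using assms by (simp add: linear_fun_iff)
  show "f (x * scalar_elem a) = a * f x"
    by (simp add: scalar_elem_central scale)
  show zero: "f 0 = 0"
    using scale [of 0 0] by simp
  show minus: "f (- x) = - f x" for x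
    using scale [of "-1" x] by (simp add: scalar_elem_simps)
  show "f (x - y) = f x - f y"
    using add [of x "- y"] minus by simp
  show "f (\<Sum>i\<in>A. h i) = (\<Sum>i\<in>A. f (h i))"
    by (induction A rule: infinite_finite_induct) (simp_all add: zero add)
qed

lemma linear_fun_eqI:
  assumes f: "linear_fun f" and g: "linear_fun g"
    and eq: "\<And>w. f (Poly_Mapping.single (Word w) 1) = g (Poly_Mapping.single (Word w) 1)"
  shows "f x = g x"
proof -
  have eq': "f (Poly_Mapping.single w a) = g (Poly_Mapping.single w a)" for w a
    using linear_fun_scale [OF f, of a "Poly_Mapping.single w 1"]
      linear_fun_scale [OF g, of a "Poly_Mapping.single w 1"] eq [of "letters w"]
    by (simp add: scalar_elem_times_single)
  have "f (\<Sum>w\<in>Poly_Mapping.keys x. Poly_Mapping.single w (Poly_Mapping.lookup x w))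
      = g (\<Sum>w\<in>Poly_Mapping.keys x. Poly_Mapping.single w (Poly_Mapping.lookup x w))"
    by (simp add: linear_fun_sum [OF f] linear_fun_sum [OF g] eq')
  then show ?thesis
    by (simp only: poly_mapping_eq_sum_single [of x, symmetric])
qed

text \<open>Identities between bilinear expressions, such as the multiplicativity of a functional or the
  coboundary equation, need to be checked on pairs of words only.\<close>

lemma bilinear_fun_eqI:
  assumes f: "\<And>x. linear_fun (f x)" "\<And>y. linear_fun (\<lambda>x. f x y)"
    and g: "\<And>x. linear_fun (g x)" "\<And>y. linear_fun (\<lambda>x. g x y)"
    and eq: "\<And>v w. f (Poly_Mapping.single (Word v) 1) (Poly_Mapping.single (Word w) 1)
             = g (Poly_Mapping.single (Word v) 1) (Poly_Mapping.single (Word w) 1)"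
  shows "f x y = g x y"
proof -
  have "f (Poly_Mapping.single (Word v) 1) y = g (Poly_Mapping.single (Word v) 1) y" for v
    by (rule linear_fun_eqI [OF f(1) g(1) eq])
  then show ?thesis
    by (rule linear_fun_eqI [OF f(2) g(2)])
qed

lemma linear_fun_const_0: "linear_fun (\<lambda>x. 0)"
  by (simp add: linear_fun_iff)

lemma linear_fun_plus: "linear_fun f \<Longrightarrow> linear_fun g \<Longrightarrow> linear_fun (\<lambda>x. f x + g x)"
  by (simp add: linear_fun_iff algebra_simps)

lemma linear_fun_minusI: "linear_fun f \<Longrightarrow> linear_fun g \<Longrightarrow> linear_fun (\<lambda>x. f x - g x)"
  by (simp add: linear_fun_iff algebra_simps)

lemma linear_fun_cmult: "linear_fun f \<Longrightarrow> linear_fun (\<lambda>x. a * f x)"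
  by (simp add: linear_fun_iff algebra_simps)

lemma linear_fun_multc: "linear_fun f \<Longrightarrow> linear_fun (\<lambda>x. f x * a)"
  by (simp add: linear_fun_iff algebra_simps)

lemma linear_fun_setsum: "(\<And>i. i \<in> A \<Longrightarrow> linear_fun (f i)) \<Longrightarrow> linear_fun (\<lambda>x. \<Sum>i\<in>A. f i x)"
  by (simp add: linear_fun_iff sum.distrib sum_distrib_left)

lemma linear_fun_times_left:
  assumes "linear_fun f"
  shows "linear_fun (\<lambda>x. f (y * x))"
proof -
  have "y * (scalar_elem a * x) = scalar_elem a * (y * x)" for a x
    by (simp add: scalar_elem_central flip: mult.assoc)
  then show ?thesis
    using assms by (simp add: linear_fun_iff distrib_left)
qed

lemma linear_fun_times_right: "linear_fun f \<Longrightarrow> linear_fun (\<lambda>x. f (x * y))"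
  by (simp add: linear_fun_iff distrib_right mult.assoc)

lemmas linear_fun_intros = linear_fun_const_0 linear_fun_plus linear_fun_minusI linear_fun_cmult
  linear_fun_multc linear_fun_setsum linear_fun_times_left linear_fun_times_right

definition lin_ext :: "('n gen list \<Rightarrow> complex) \<Rightarrow> 'n free_star_alg \<Rightarrow> complex" where
  "lin_ext \<phi> x = (\<Sum>w \<in> Poly_Mapping.keys x. Poly_Mapping.lookup x w * \<phi> (letters w))"

lemma linear_fun_lin_ext: "linear_fun (lin_ext \<phi>)"
proof -
  have sup: "lin_ext \<phi> x = (\<Sum>w\<in>A. Poly_Mapping.lookup x w * \<phi> (letters w))" if "finite A" "Poly_Mapping.keys x \<subseteq> A" for A x
    unfolding lin_ext_def
    by (rule sum.mono_neutral_left) (use that in \<open>auto simp: in_keys_iff\<close>)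
  have "lin_ext \<phi> (x + y) = lin_ext \<phi> x + lin_ext \<phi> y" for x y
    unfolding lin_ext_def by (rule setsum_keys_plus_distrib) (auto simp: algebra_simps)
  moreover have "lin_ext \<phi> (scalar_elem a * x) = a * lin_ext \<phi> x" for a x
  proof -
    have "lin_ext \<phi> (scalar_elem a * x)
        = (\<Sum>w\<in>Poly_Mapping.keys x. Poly_Mapping.lookup (scalar_elem a * x) w * \<phi> (letters w))"
      by (rule sup) (auto simp: in_keys_iff lookup_scalar_elem_times)
    then show ?thesis
      by (simp add: lookup_scalar_elem_times lin_ext_def sum_distrib_left mult.assoc)
  qed
  ultimately show ?thesis
    by (simp add: linear_fun_iff)
qed

lemma lin_ext_word [simp]: "lin_ext \<phi> (Poly_Mapping.single (Word w) 1) = \<phi> w"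
  by (simp add: lin_ext_def)

lemma lin_ext_one: "lin_ext \<phi> 1 = \<phi> []"
  using lin_ext_word [of \<phi> "[]"] by (simp flip: zero_free_word_def)

lemma lin_ext_gen [simp]: "lin_ext \<phi> (gen_elem g) = \<phi> [g]"
  by (simp add: gen_elem_def)

lemma single_word_times:
  "Poly_Mapping.single (Word v) 1 * Poly_Mapping.single (Word w) 1
     = (Poly_Mapping.single (Word (v @ w)) 1 :: 'n free_star_alg)"
  by (simp add: mult_single plus_free_word_def)

text \<open>The index set \<open>C\<close> makes this cover both characters (a singleton) and the entries of a matrix
  representation.\<close>

lemma lin_ext_times:
  assumes "\<And>v w. \<phi> (v @ w) = (\<Sum>c\<in>C. \<alpha> c v * \<beta> c w)"
  shows "lin_ext \<phi> (x * y) = (\<Sum>c\<in>C. lin_ext (\<alpha> c) x * lin_ext (\<beta> c) y)"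
proof (rule bilinear_fun_eqI)
  show "lin_ext \<phi> (Poly_Mapping.single (Word v) 1 * Poly_Mapping.single (Word w) 1)
      = (\<Sum>c\<in>C. lin_ext (\<alpha> c) (Poly_Mapping.single (Word v) 1)
               * lin_ext (\<beta> c) (Poly_Mapping.single (Word w) 1))" for v w
    by (simp add: single_word_times assms)
qed (intro linear_fun_intros linear_fun_lin_ext)+

abbreviation word_counit :: "'n gen list \<Rightarrow> complex" where
  "word_counit w \<equiv> prod_list (map gen_counit w)"

lemma free_counit_eq_lin_ext: "free_counit = lin_ext word_counit"
  by (simp add: fun_eq_iff free_counit_def lin_ext_def)

lemma linear_fun_free_counit: "linear_fun free_counit"
  unfolding free_counit_eq_lin_ext by (rule linear_fun_lin_ext)

lemma free_counit_times [simp]: "free_counit (x * y) = free_counit x * free_counit y"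
  using lin_ext_times [where C = "{()}" and \<phi> = word_counit and \<alpha> = "\<lambda>_. word_counit"
      and \<beta> = "\<lambda>_. word_counit"]
  by (simp add: free_counit_eq_lin_ext)

lemma free_counit_simps [simp]:
  "free_counit (x + y) = free_counit x + free_counit y"
  "free_counit (x - y) = free_counit x - free_counit y"
  "free_counit (- x) = - free_counit x"
  "free_counit (scalar_elem a) = a"
  "free_counit 0 = 0" "free_counit 1 = 1"
  "free_counit (gen_elem g) = gen_counit g"
  "free_counit (\<Sum>i\<in>A. h i) = (\<Sum>i\<in>A. free_counit (h i))"
  using linear_fun_scale [OF linear_fun_free_counit, of a 1]
  by (simp_all add: linear_fun_add linear_fun_diff linear_fun_minus linear_fun_zero linear_fun_sum
      linear_fun_free_counit)
    (simp_all add: free_counit_eq_lin_ext lin_ext_one)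


section \<open>Vanishing of the second cohomology of the free algebra\<close>

abbreviation free_cocycles :: "('n free_star_alg \<Rightarrow> 'n free_star_alg \<Rightarrow> complex) set" where
  "free_cocycles \<equiv> hochschild_cocycles2 free_algebra free_counit"

lemma free_cocycles_iff:
  "b \<in> free_cocycles \<longleftrightarrow>
     (\<forall>x. linear_fun (b x)) \<and> (\<forall>y. linear_fun (\<lambda>x. b x y)) \<and>
     (\<forall>x y z. free_counit x * b y z - b (x * y) z + b x (y * z) - b x y * free_counit z = 0)"
  by (simp add: hochschild_cocycles2_def)

text \<open>The last condition is the equation \<open>b = \<partial>\<psi>\<close>, solved for the value at a product.\<close>

definition primitive :: "('n free_star_alg \<Rightarrow> 'n free_star_alg \<Rightarrow> complex) \<Rightarrow>
    ('n free_star_alg \<Rightarrow> complex) \<Rightarrow> bool" where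
  "primitive b \<psi> \<longleftrightarrow> linear_fun \<psi> \<and>
     (\<forall>x y. \<psi> (x * y) = free_counit x * \<psi> y + \<psi> x * free_counit y - b x y)"

lemma primitive_linear: "primitive b \<psi> \<Longrightarrow> linear_fun \<psi>"
  by (simp add: primitive_def)

lemma primitive_times:
  "primitive b \<psi> \<Longrightarrow> \<psi> (x * y) = free_counit x * \<psi> y + \<psi> x * free_counit y - b x y"
  by (simp add: primitive_def)

lemma primitive_add:
  assumes "primitive b \<psi>" "primitive b' \<psi>'"
  shows "primitive (\<lambda>x y. b x y + b' x y) (\<lambda>x. \<psi> x + \<psi>' x)"
  unfolding primitive_def
  by (simp add: linear_fun_plus assms [THEN primitive_linear] assms [THEN primitive_times]
      algebra_simps)

lemma primitive_diff:
  assumes "primitive b \<psi>" "primitive b' \<psi>'"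
  shows "primitive (\<lambda>x y. b x y - b' x y) (\<lambda>x. \<psi> x - \<psi>' x)"
  unfolding primitive_def
  by (simp add: linear_fun_minusI assms [THEN primitive_linear] assms [THEN primitive_times]
      algebra_simps)

lemma primitive_scale:
  assumes "primitive b \<psi>"
  shows "primitive (\<lambda>x y. a * b x y) (\<lambda>x. a * \<psi> x)"
  unfolding primitive_def
  by (simp add: linear_fun_cmult primitive_linear [OF assms] primitive_times [OF assms]
      algebra_simps)

fun word_primitive :: "('n free_star_alg \<Rightarrow> 'n free_star_alg \<Rightarrow> complex) \<Rightarrow>
    ('n gen \<Rightarrow> complex) \<Rightarrow> 'n gen list \<Rightarrow> complex" where
  "word_primitive b t [] = b 1 1"
| "word_primitive b t (g # w) = gen_counit g * word_primitive b t w + t g * word_counit w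
     - b (gen_elem g) (Poly_Mapping.single (Word w) 1)"

lemma free_cocycle_eq:
  assumes "b \<in> free_cocycles"
  shows "b x (y * z) = b x y * free_counit z + b (x * y) z - free_counit x * b y z"
proof -
  have "free_counit x * b y z - b (x * y) z + b x (y * z) - b x y * free_counit z = 0"
    using assms[unfolded free_cocycles_iff] by blast
  then show ?thesis by (simp add: algebra_simps)
qed

lemma free_cocycle_one_left: "b \<in> free_cocycles \<Longrightarrow> b 1 y = b 1 1 * free_counit y"
  using free_cocycle_eq [of b 1 1 y] by simp

lemma free_cocycle_one_right: "b \<in> free_cocycles \<Longrightarrow> b x 1 = free_counit x * b 1 1"
  using free_cocycle_eq [of b x 1 1] by simp

lemma free_cocycles_add:
  assumes "b \<in> free_cocycles" "b' \<in> free_cocycles"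
  shows "(\<lambda>x y. b x y + b' x y) \<in> free_cocycles"
  unfolding free_cocycles_iff
  using assms [unfolded free_cocycles_iff]
  by (simp add: linear_fun_plus free_cocycle_eq [OF assms(1)] free_cocycle_eq [OF assms(2)]
      algebra_simps)

lemma free_cocycles_scale:
  assumes "b \<in> free_cocycles"
  shows "(\<lambda>x y. a * b x y) \<in> free_cocycles"
  unfolding free_cocycles_iff
  using assms [unfolded free_cocycles_iff]
  by (simp add: linear_fun_cmult free_cocycle_eq [OF assms] algebra_simps)

text \<open>The coboundary equation is a recursion along words, started by the values \<open>t\<close> on the
  generators; the cocycle identity makes the result independent of where a word is split. The freedom
  in \<open>t\<close> yields, for \<open>b = 0\<close>, derivations with prescribed values.\<close>

lemma free_cocycle_primitive:
  assumes b: "b \<in> free_cocycles"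
  shows "\<exists>\<psi>. primitive b \<psi> \<and> (\<forall>g. \<psi> (gen_elem g) = t g)"
proof (intro exI conjI allI)
  let ?s = "\<lambda>w. Poly_Mapping.single (Word w) (1::complex)"
  let ?p = "word_primitive b t"
  note coc = free_cocycle_eq [OF b]
  have eps: "free_counit (?s w) = word_counit w" for w
    by (simp add: free_counit_eq_lin_ext)
  have words: "?p (v @ w) = word_counit v * ?p w + ?p v * word_counit w - b (?s v) (?s w)" for v w
  proof (induction v)
    case Nil
    show ?case
      using free_cocycle_one_left [OF b, of "?s w"] by (simp add: eps flip: zero_free_word_def)
  next
    case (Cons g v)
    have vw: "?s (v @ w) = ?s v * ?s w" and gv: "?s (g # v) = gen_elem g * ?s v"
      using single_word_times [of "[g]" v] by (simp_all add: single_word_times gen_elem_def)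
    show ?case
      by (simp add: Cons.IH vw gv coc eps) (simp add: algebra_simps)
  qed
  show "lin_ext ?p (gen_elem g) = t g" for g
    using free_cocycle_one_right [OF b, of "gen_elem g"]
    by (simp flip: zero_free_word_def)
  have "lin_ext ?p (x * y) = free_counit x * lin_ext ?p y + lin_ext ?p x * free_counit y - b x y"
    for x y
  proof (rule bilinear_fun_eqI)
    have lin: "linear_fun (b x)" "linear_fun (\<lambda>x. b x y)" for x y
      using b by (simp_all add: free_cocycles_iff)
    show "linear_fun (\<lambda>y. free_counit x * lin_ext ?p y + lin_ext ?p x * free_counit y - b x y)"
      "linear_fun (\<lambda>x. free_counit x * lin_ext ?p y + lin_ext ?p x * free_counit y - b x y)" for x y
      by (intro linear_fun_intros linear_fun_lin_ext linear_fun_free_counit lin)+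
    show "lin_ext ?p (?s v * ?s w)
        = free_counit (?s v) * lin_ext ?p (?s w) + lin_ext ?p (?s v) * free_counit (?s w)
          - b (?s v) (?s w)" for v w
      by (simp add: single_word_times words eps)
  qed (intro linear_fun_intros linear_fun_lin_ext)+
  then show "primitive b (lin_ext ?p)"
    by (simp add: primitive_def linear_fun_lin_ext)
qed


section \<open>Matrices over the free algebra\<close>

lemma matrix_matrix_mult_nth: "(M ** N) $ j $ k = (\<Sum>l\<in>UNIV. M $ j $ l * N $ l $ k)"
  by (simp add: matrix_matrix_mult_def)

lemma mat_eq_iff: "M = N \<longleftrightarrow> (\<forall>j k. M $ j $ k = N $ j $ k)"
  by (simp add: vec_eq_iff)

lemma const_mat_nth [simp]: "const_mat A $ j $ k = scalar_elem (A $ j $ k)"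
  by (simp add: const_mat_def)

lemma gen_mat_nth [simp]:
  "u_mat $ j $ k = gen_elem (U j k)" "ubar_mat $ j $ k = gen_elem (Ustar j k)"
  "ustar_mat $ j $ k = gen_elem (Ustar k j)"
  by (simp_all add: u_mat_def ubar_mat_def ustar_mat_def transpose_def)

lemma scalar_elem_sum: "scalar_elem (\<Sum>i\<in>A. h i) = (\<Sum>i\<in>A. scalar_elem (h i))"
  by (induction A rule: infinite_finite_induct) (simp_all add: scalar_elem_simps)

lemma const_mat_mult: "const_mat A ** const_mat B = const_mat (A ** B)"
  by (simp add: mat_eq_iff matrix_matrix_mult_nth scalar_elem_simps scalar_elem_sum)

lemma const_mat_one: "const_mat (mat 1) = mat 1"
  by (simp add: mat_eq_iff mat_def scalar_elem_simps)

lemma matrix_diff_ldistrib: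
  fixes A :: "('a::ring_1)^'n^'m"
  shows "A ** (B - C) = A ** B - A ** C"
  by (simp add: mat_eq_iff matrix_matrix_mult_nth right_diff_distrib sum_subtractf)

lemma matrix_diff_rdistrib:
  fixes C :: "('a::ring_1)^'n^'m"
  shows "(A - B) ** C = A ** C - B ** C"
  by (simp add: mat_eq_iff matrix_matrix_mult_nth left_diff_distrib sum_subtractf)

lemma matrix_add_rdistrib:
  fixes C :: "('a::semiring_1)^'n^'m"
  shows "(A + B) ** C = A ** C + B ** C"
  by (simp add: mat_eq_iff matrix_matrix_mult_nth distrib_right sum.distrib)

lemma transpose_diff: "transpose (A - B) = transpose A - transpose B"
  by (simp add: mat_eq_iff transpose_def)

lemma transpose_add: "transpose (A + B) = transpose A + transpose B"
  by (simp add: mat_eq_iff transpose_def)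

lemma transpose_zero: "transpose 0 = 0"
  by (simp add: mat_eq_iff transpose_def)

lemma transpose_sum: "transpose (\<Sum>i\<in>K. h i) = (\<Sum>i\<in>K. transpose (h i))"
  by (simp add: mat_eq_iff transpose_def)

lemma matrix_mult_lminus: "(- A) ** B = - (A ** (B :: ('a::ring_1)^'n^'m))"
  by (simp add: mat_eq_iff matrix_matrix_mult_nth sum_negf)

lemma matrix_mult_rminus: "A ** (- B) = - (A ** (B :: ('a::ring_1)^'n^'m))"
  by (simp add: mat_eq_iff matrix_matrix_mult_nth sum_negf)

lemma sum_matrix_mult_right:
  "(\<Sum>i\<in>K. h i ** (A :: ('a::ring_1)^'n^'n)) = (\<Sum>i\<in>K. h i) ** A"
  by (induction K rule: infinite_finite_induct) (simp_all add: matrix_add_rdistrib)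

lemma sum_matrix_mult_left:
  "(\<Sum>i\<in>K. A ** h i) = (A :: ('a::ring_1)^'n^'n) ** (\<Sum>i\<in>K. h i)"
  by (induction K rule: infinite_finite_induct) (simp_all add: matrix_add_ldistrib)

lemma trace_diff: "trace (A - B) = trace A - trace (B :: ('a::ring_1)^'m^'m)"
  by (simp add: trace_def sum_subtractf)

lemma trace_uminus: "trace (- A) = - trace (A :: ('a::ring_1)^'m^'m)"
  by (simp add: trace_def sum_negf)

lemma trace_transpose_mult: "trace (A ** transpose B) = trace (transpose A ** (B :: ('a::comm_semiring_1)^'n^'n))"
  unfolding trace_def matrix_matrix_mult_nth transpose_def
  by (subst sum.swap) simp

lemma
  fixes M N :: "('n::finite free_star_alg)^'n^'n"
  assumes "linear_fun f"
  shows map_matrix_const_mult: "map_matrix f (const_mat A ** M) = A ** map_matrix f M"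
    and map_matrix_mult_const: "map_matrix f (M ** const_mat A) = map_matrix f M ** A"
    and map_matrix_diff: "map_matrix f (M - N) = map_matrix f M - map_matrix f N"
  by (simp_all add: mat_eq_iff matrix_matrix_mult_nth linear_fun_sum [OF assms]
      linear_fun_scale [OF assms] linear_fun_scale_right [OF assms] linear_fun_diff [OF assms]
      mult.commute)

lemma map_matrix_times_add:
  "map_matrix ((*) a) (A + B) = map_matrix ((*) a) A + map_matrix ((*) a) (B :: complex^'n^'m)"
  by (simp add: mat_eq_iff distrib_left)

lemma map_matrix_transpose: "map_matrix f (transpose M) = transpose (map_matrix f M)"
  by (simp add: mat_eq_iff transpose_def)

lemma map_matrix_ustar: "map_matrix f ustar_mat = transpose (map_matrix f ubar_mat)"
  by (simp add: ustar_mat_def map_matrix_transpose)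

lemma map_matrix_counit_mult:
  "map_matrix free_counit (M ** N) = map_matrix free_counit M ** map_matrix free_counit N"
  by (simp add: mat_eq_iff matrix_matrix_mult_nth)

lemma map_matrix_counit_simps [simp]:
  "map_matrix free_counit u_mat = mat 1" "map_matrix free_counit ubar_mat = mat 1"
  "map_matrix free_counit ustar_mat = mat 1" "map_matrix free_counit (transpose u_mat) = mat 1"
  "map_matrix free_counit (const_mat A) = A" "map_matrix free_counit (mat 1) = mat 1"
  by (simp_all add: mat_eq_iff mat_def transpose_def)


section \<open>The defining ideal\<close>

definition rel_unitary :: "('n::finite free_star_alg)^'n^'n" where
  "rel_unitary = u_mat ** ustar_mat - mat 1"

definition rel_unitary' :: "('n::finite free_star_alg)^'n^'n" where
  "rel_unitary' = ustar_mat ** u_mat - mat 1"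

definition rel_twisted :: "complex^'n^'n \<Rightarrow> ('n::finite free_star_alg)^'n^'n" where
  "rel_twisted Q =
     transpose u_mat ** const_mat Q ** ubar_mat ** const_mat (matrix_inv Q) - mat 1"

definition rel_twisted' :: "complex^'n^'n \<Rightarrow> ('n::finite free_star_alg)^'n^'n" where
  "rel_twisted' Q =
     const_mat Q ** ubar_mat ** const_mat (matrix_inv Q) ** transpose u_mat - mat 1"

lemmas rel_defs = rel_unitary_def rel_unitary'_def rel_twisted_def rel_twisted'_def

lemma Au_relations_eq:
  "Au_relations Q =
     {R $ j $ k |R j k. R \<in> {rel_unitary, rel_unitary', rel_twisted Q, rel_twisted' Q}}"
  unfolding Au_relations_def rel_defs by blast

text \<open>The library notion of an ideal of \<^const>\<open>free_algebra\<close> in terms of the type class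
  operations.\<close>

definition two_sided_ideal :: "'n free_star_alg set \<Rightarrow> bool" where
  "two_sided_ideal J \<longleftrightarrow> 0 \<in> J \<and> (\<forall>x\<in>J. \<forall>y\<in>J. x + y \<in> J) \<and>
     (\<forall>x. \<forall>y\<in>J. x * y \<in> J \<and> y * x \<in> J)"

lemma ring_free_algebra: "ring (free_algebra :: (complex, 'n free_star_alg) module)"
proof (rule ringI)
  show "abelian_group (free_algebra :: (complex, 'n free_star_alg) module)"
  proof (rule abelian_groupI)
    show "\<exists>y\<in>carrier free_algebra. y \<oplus>\<^bsub>free_algebra\<^esub> x = \<zero>\<^bsub>free_algebra\<^esub>"
      for x :: "'n free_star_alg"
      by (simp add: exI [of _ "- x"])
  qed (simp_all add: add.assoc add.commute)
  show "Group.monoid (free_algebra :: (complex, 'n free_star_alg) module)"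
    by (rule Group.monoidI) (simp_all add: mult.assoc)
qed (simp_all add: distrib_left distrib_right)

lemma ideal_free_algebra_iff: "ideal J free_algebra \<longleftrightarrow> two_sided_ideal J"
proof
  assume "ideal J free_algebra"
  then interpret ideal J free_algebra .
  show "two_sided_ideal J"
    using additive_subgroup.zero_closed [OF additive_subgroup_axioms]
      additive_subgroup.a_closed [OF additive_subgroup_axioms] I_l_closed I_r_closed
    by (simp add: two_sided_ideal_def)
next
  assume J: "two_sided_ideal J"
  then have "- 1 * x \<in> J" if "x \<in> J" for x
    using that unfolding two_sided_ideal_def by blast
  then have neg: "- x \<in> J" if "x \<in> J" for x
    using that by simp
  show "ideal J free_algebra"
  proof (rule idealI [OF ring_free_algebra])
    interpret ring "free_algebra :: (complex, 'a free_star_alg) module"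
      by (rule ring_free_algebra)
    have inv: "inv\<^bsub>add_monoid free_algebra\<^esub> x = - x" for x :: "'a free_star_alg"
    proof -
      have "\<ominus>\<^bsub>free_algebra\<^esub> x = - x"
        by (rule minus_equality) simp_all
      then show ?thesis
        by (simp add: a_inv_def)
    qed
    show "subgroup J (add_monoid free_algebra)"
    proof (rule subgroup.intro)
      show "inv\<^bsub>add_monoid free_algebra\<^esub> x \<in> J" if "x \<in> J" for x
        using neg [OF that] by (simp only: inv)
    qed (use J in \<open>simp_all add: two_sided_ideal_def\<close>)
  qed (use J in \<open>auto simp: two_sided_ideal_def\<close>)
qed

definition entries_in :: "'a set \<Rightarrow> 'a^'n^'m \<Rightarrow> bool" where
  "entries_in J M \<longleftrightarrow> (\<forall>j k. M $ j $ k \<in> J)"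

lemma two_sided_ideal_sum:
  assumes "two_sided_ideal J" "\<And>i. i \<in> A \<Longrightarrow> h i \<in> J"
  shows "(\<Sum>i\<in>A. h i) \<in> J"
  using assms by (induction A rule: infinite_finite_induct) (auto simp: two_sided_ideal_def)

lemma
  assumes "two_sided_ideal J" "entries_in J R"
  shows entries_in_mult_left: "entries_in J (M ** R)"
    and entries_in_mult_right: "entries_in J (R ** M)"
  using assms
  by (auto simp: entries_in_def matrix_matrix_mult_nth two_sided_ideal_def
      intro!: two_sided_ideal_sum)

subsection \<open>The adjoint relations\<close>

lemma free_star_add: "free_star (x + y) = free_star x + free_star y"
  unfolding free_star_def
  by (rule setsum_keys_plus_distrib) (simp_all add: single_add)

lemma free_star_zero: "free_star 0 = 0"
  by (simp add: free_star_def)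

lemma free_star_sum: "free_star (\<Sum>i\<in>A. h i) = (\<Sum>i\<in>A. free_star (h i))"
  by (induction A rule: infinite_finite_induct) (simp_all add: free_star_add free_star_zero)

lemma free_star_single:
  "free_star (Poly_Mapping.single w a) = Poly_Mapping.single (word_star w) (cnj a)"
  by (simp add: free_star_def)

lemma free_star_minus: "free_star (- x) = - free_star x"
  using free_star_add [of x "- x"] by (simp add: free_star_zero eq_neg_iff_add_eq_0 add.commute)

lemma free_star_diff: "free_star (x - y) = free_star x - free_star y"
  using free_star_add [of x "- y"] by (simp add: free_star_minus)

lemma word_star_plus: "word_star (v + w) = word_star w + word_star v"
  by (simp add: word_star_def plus_free_word_def)

lemma free_star_times: "free_star (x * y) = free_star y * free_star x"
proof -
  let ?e = "\<lambda>x. \<Sum>w\<in>Poly_Mapping.keys x. Poly_Mapping.single w (Poly_Mapping.lookup x w)"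
  have "free_star (?e x * ?e y) = free_star (?e y) * free_star (?e x)"
    by (simp add: sum_product free_star_sum mult_single free_star_single word_star_plus mult.commute)
      (rule sum.swap)
  then show ?thesis
    by (simp only: poly_mapping_eq_sum_single [of x, symmetric]
        poly_mapping_eq_sum_single [of y, symmetric])
qed

lemma free_star_simps [simp]:
  "free_star (gen_elem g) = gen_elem (gen_star g)"
  "free_star (scalar_elem a) = scalar_elem (cnj a)"
  "free_star 1 = 1"
  using free_star_single [of 0 1]
  by (simp_all add: gen_elem_def scalar_elem_def free_star_single word_star_def zero_free_word_def
      flip: single_one)

text \<open>The star is an anti-automorphism, so the entrywise star followed by transposition reverses
  matrix products. It fixes the two unitarity relations and conjugates the two twisted ones by
  \<open>Q\<close>. Hence the adjoint relations already belong to the ideal generated by the relations, and only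
  the four original matrices have to be considered below.\<close>

definition dagger :: "('n::finite free_star_alg)^'n^'n \<Rightarrow> ('n free_star_alg)^'n^'n" where
  "dagger M = transpose (map_matrix free_star M)"

lemma dagger_mult: "dagger (M ** N) = dagger N ** dagger M"
  by (simp add: dagger_def mat_eq_iff transpose_def matrix_matrix_mult_nth free_star_sum
      free_star_times)

lemma dagger_simps:
  "dagger (M - N) = dagger M - dagger N"
  "dagger u_mat = ustar_mat" "dagger ustar_mat = u_mat"
  "dagger ubar_mat = transpose u_mat" "dagger (transpose u_mat) = ubar_mat"
  "dagger (mat 1) = mat 1"
  "dagger (const_mat A) = const_mat (transpose (map_matrix cnj A))"
  by (simp_all add: dagger_def mat_eq_iff transpose_def free_star_diff mat_def free_star_zero)

locale hermitian_invertible =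
  fixes Q :: "complex^'n::finite^'n" and P :: "complex^'n^'n"
  assumes inverse: "Q ** P = mat 1" "P ** Q = mat 1"
    and hermitian: "transpose (map_matrix cnj Q) = Q"
begin

lemma matrix_inv_eq: "matrix_inv Q = P"
proof -
  have "matrix_inv Q ** Q = mat 1"
    unfolding matrix_inv_def using inverse by (rule_tac someI2 [of _ P]) simp_all
  then have "matrix_inv Q ** Q ** P = P"
    by simp
  then show ?thesis
    by (simp add: inverse flip: matrix_mul_assoc)
qed

lemma hermitian_inverse: "transpose (map_matrix cnj P) = P"
proof -
  let ?a = "\<lambda>A :: complex^'n^'n. transpose (map_matrix cnj A)"
  have "?a (Q ** P) = ?a P ** ?a Q"
    by (simp add: mat_eq_iff transpose_def matrix_matrix_mult_nth mult.commute)
  moreover have "?a (mat 1) = mat 1"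
    by (simp add: mat_eq_iff transpose_def mat_def)
  ultimately have "?a P ** Q = mat 1"
    by (simp add: inverse hermitian)
  then have "?a P ** Q ** P = P"
    by simp
  then show ?thesis
    by (simp add: inverse flip: matrix_mul_assoc)
qed

lemma const_inverse:
  "const_mat Q ** const_mat P = mat 1" "const_mat P ** const_mat Q = mat 1"
  by (simp_all add: const_mat_mult inverse const_mat_one)

lemma const_inverse_left:
  "const_mat Q ** (const_mat P ** M) = M" "const_mat P ** (const_mat Q ** M) = M"
  by (simp_all add: const_inverse matrix_mul_assoc)

lemma dagger_rel:
  "dagger rel_unitary = (rel_unitary :: ('n free_star_alg)^'n^'n)"
  "dagger rel_unitary' = (rel_unitary' :: ('n free_star_alg)^'n^'n)"
  "dagger (rel_twisted Q) = const_mat P ** rel_twisted Q ** const_mat Q"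
  "dagger (rel_twisted' Q) = const_mat P ** rel_twisted' Q ** const_mat Q"
  by (simp_all add: rel_defs matrix_inv_eq dagger_mult dagger_simps hermitian hermitian_inverse
      matrix_diff_ldistrib matrix_diff_rdistrib const_inverse const_inverse_left
      flip: matrix_mul_assoc)

abbreviation "I \<equiv> Au_ideal Q"

lemma ideal_I: "ideal I free_algebra"
  unfolding Au_ideal_def by (rule ring.genideal_ideal [OF ring_free_algebra]) simp

lemma two_sided_I: "two_sided_ideal I"
  using ideal_I by (simp add: ideal_free_algebra_iff)

lemma I_subset:
  assumes J: "two_sided_ideal J"
    and rel: "entries_in J rel_unitary" "entries_in J rel_unitary'"
      "entries_in J (rel_twisted Q)" "entries_in J (rel_twisted' Q)"
  shows "I \<subseteq> J"
  unfolding Au_ideal_def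
proof (rule ring.genideal_minimal [OF ring_free_algebra])
  show "ideal J free_algebra"
    using J by (simp add: ideal_free_algebra_iff)
  have "entries_in J (dagger R)" if "R \<in> {rel_unitary, rel_unitary', rel_twisted Q, rel_twisted' Q}" for R
  proof -
    have "entries_in J (A ** R ** B)" if "entries_in J R" for A R B :: "('n free_star_alg)^'n^'n"
      by (rule entries_in_mult_right [OF J entries_in_mult_left [OF J that]])
    then show ?thesis
      using that rel by (auto simp: dagger_rel)
  qed
  moreover have "free_star (R $ j $ k) = dagger R $ k $ j" for R :: "('n free_star_alg)^'n^'n" and j k
    by (simp add: dagger_def transpose_def)
  ultimately show "Au_relations Q \<union> free_star ` Au_relations Q \<subseteq> J"
    using rel unfolding Au_relations_eq entries_in_def by fastforce
qed

lemma rel_in_I: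
  "entries_in I rel_unitary" "entries_in I rel_unitary'"
  "entries_in I (rel_twisted Q)" "entries_in I (rel_twisted' Q)"
proof -
  have "Au_relations Q \<subseteq> I"
    unfolding Au_ideal_def
    using ring.genideal_self [OF ring_free_algebra, of "Au_relations Q \<union> free_star ` Au_relations Q"]
    by simp
  then show "entries_in I rel_unitary" "entries_in I rel_unitary'"
    "entries_in I (rel_twisted Q)" "entries_in I (rel_twisted' Q)"
    unfolding Au_relations_eq entries_in_def by blast+
qed

lemma I_closed:
  "0 \<in> I" "x \<in> I \<Longrightarrow> y \<in> I \<Longrightarrow> x + y \<in> I" "y \<in> I \<Longrightarrow> x * y \<in> I" "y \<in> I \<Longrightarrow> y * x \<in> I"
  using two_sided_I by (auto simp: two_sided_ideal_def)

lemma I_uminus: "x \<in> I \<Longrightarrow> - x \<in> I"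
  using I_closed(3) [of x "- 1"] by simp

lemma I_diff: "x \<in> I \<Longrightarrow> y \<in> I \<Longrightarrow> x - y \<in> I"
  using I_closed(2) [of x "- y"] I_uminus [of y] by simp

lemma counit_I:
  assumes "x \<in> I"
  shows "free_counit x = 0"
proof -
  have "I \<subseteq> {x. free_counit x = 0}"
  proof (rule I_subset)
    have "map_matrix free_counit R = 0"
      if "(R :: ('n free_star_alg)^'n^'n) \<in> {rel_unitary, rel_unitary', rel_twisted Q, rel_twisted' Q}" for R
      using that
      by (auto simp: rel_defs matrix_inv_eq map_matrix_diff [OF linear_fun_free_counit] map_matrix_counit_mult inverse)
    then have "entries_in {x. free_counit x = 0} R"
      if "R \<in> {rel_unitary, rel_unitary', rel_twisted Q, rel_twisted' Q}" for R
      using that by (simp add: entries_in_def mat_eq_iff)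
    then show
      "entries_in {x. free_counit x = 0} (rel_unitary :: ('n free_star_alg)^'n^'n)"
      "entries_in {x. free_counit x = 0} (rel_unitary' :: ('n free_star_alg)^'n^'n)"
      "entries_in {x. free_counit x = 0} (rel_twisted Q)"
      "entries_in {x. free_counit x = 0} (rel_twisted' Q)"
      by simp_all
  qed (simp add: two_sided_ideal_def)
  then show ?thesis
    using assms by blast
qed


section \<open>The quotient algebra\<close>

definition proj :: "'n free_star_alg \<Rightarrow> 'n free_star_alg set" where
  "proj x = I +>\<^bsub>free_algebra\<^esub> x"

lemma proj_eq_image: "proj x = (\<lambda>h. h + x) ` I"
  by (auto simp: proj_def a_r_coset_def r_coset_def)

lemma proj_eq_iff: "proj x = proj y \<longleftrightarrow> x - y \<in> I"
proof
  assume "proj x = proj y"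
  moreover have "x \<in> proj x"
    using I_closed(1) by (force simp: proj_eq_image)
  ultimately show "x - y \<in> I"
    by (auto simp: proj_eq_image)
next
  assume xy: "x - y \<in> I"
  show "proj x = proj y"
    unfolding proj_eq_image
  proof (intro equalityI image_subsetI)
    show "h + x \<in> (\<lambda>h. h + y) ` I" if "h \<in> I" for h
      by (rule image_eqI [of _ _ "h + (x - y)"]) (use that xy I_closed in auto)
    show "h + y \<in> (\<lambda>h. h + x) ` I" if "h \<in> I" for h
      by (rule image_eqI [of _ _ "h - (x - y)"]) (use that xy I_diff in auto)
  qed
qed

lemma carrier_Au: "carrier (Au Q) = range proj"
  by (auto simp: Au_def quot_module_def ring.defs module.defs FactRing_def A_RCOSETS_def' proj_def)

lemma Au_mult: "proj x \<otimes>\<^bsub>Au Q\<^esub> proj y = proj (x * y)"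
  using ideal.rcoset_mult_add [OF ideal_I, of x y]
  by (simp add: Au_def quot_module_def ring.defs module.defs FactRing_def proj_def)

lemma Au_add: "proj x \<oplus>\<^bsub>Au Q\<^esub> proj y = proj (x + y)"
  using abelian_subgroup.a_rcos_sum [OF abelian_subgroupI3, of I free_algebra x y] ideal_I
    ring.is_abelian_group [OF ring_free_algebra]
  by (simp add: Au_def quot_module_def ring.defs module.defs FactRing_def proj_def ideal_def)

lemma Au_smult: "a \<odot>\<^bsub>Au Q\<^esub> proj x = proj (scalar_elem a * x)"
proof -
  have "proj (scalar_elem a * y) = proj (scalar_elem a * x)" if "y \<in> proj x" for y
  proof -
    have "y - x \<in> I"
      using that by (auto simp: proj_eq_image)
    then show ?thesis
      using I_closed(3) by (simp add: proj_eq_iff flip: right_diff_distrib)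
  qed
  moreover have "x \<in> proj x"
    using I_closed(1) by (force simp: proj_eq_image)
  ultimately have "(\<Union>y\<in>proj x. proj (scalar_elem a * y)) = proj (scalar_elem a * x)"
    by blast
  then show ?thesis
    by (simp add: Au_def quot_module_def ring.defs module.defs FactRing_def flip: proj_def)
qed

lemma Au_counit_proj: "Au_counit (proj x) = free_counit x"
proof -
  have "free_counit ` proj x = {free_counit x}"
    using I_closed(1) by (auto simp: proj_eq_image counit_I image_image)
  then show ?thesis
    by (simp add: Au_counit_def)
qed

lemmas Au_simps = carrier_Au Au_mult Au_add Au_smult Au_counit_proj

end


context hermitian_invertible
begin

section \<open>Functionals on the ideal and their obstruction matrix\<close>

text \<open>On \<open>I\<close>, such a functional is a bimodule map into the trivial bimodule; outside of \<open>I\<close>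
  it is an arbitrary linear extension.\<close>

definition balanced :: "('n free_star_alg \<Rightarrow> complex) \<Rightarrow> bool" where
  "balanced f \<longleftrightarrow> linear_fun f \<and>
     (\<forall>x. \<forall>r\<in>I. f (x * r) = free_counit x * f r \<and> f (r * x) = f r * free_counit x)"

lemma balanced_linear: "balanced f \<Longrightarrow> linear_fun f"
  by (simp add: balanced_def)

lemma
  assumes f: "balanced f" and R: "entries_in I R"
  shows balanced_mult_left: "map_matrix f (M ** R) = map_matrix free_counit M ** map_matrix f R"
    and balanced_mult_right: "map_matrix f (R ** M) = map_matrix f R ** map_matrix free_counit M"
proof -
  have lin: "linear_fun f"
    using f by (rule balanced_linear)
  show "map_matrix f (M ** R) = map_matrix free_counit M ** map_matrix f R"
    "map_matrix f (R ** M) = map_matrix f R ** map_matrix free_counit M"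
    using f R
    by (simp_all add: mat_eq_iff matrix_matrix_mult_nth linear_fun_sum [OF lin] balanced_def
        entries_in_def)
qed

text \<open>Multiplying \<open>u u\<^sup>* - 1\<close> by \<open>u\<close> from the right equals multiplying \<open>u\<^sup>* u - 1\<close> by
  \<open>u\<close> from the left, and \<open>u\<close> acts as the identity matrix on both sides. The twisted relations are
  linked in the same way by \<open>u\<^sup>t\<close>.\<close>

lemma balanced_rel_unitary:
  assumes f: "balanced f"
  shows "map_matrix f rel_unitary' = map_matrix f (rel_unitary :: ('n free_star_alg)^'n^'n)"
proof -
  have "rel_unitary ** u_mat = u_mat ** (rel_unitary' :: ('n free_star_alg)^'n^'n)"
    by (simp add: rel_defs matrix_diff_ldistrib matrix_diff_rdistrib matrix_mul_assoc)
  then have "map_matrix f (rel_unitary ** u_mat)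
      = map_matrix f (u_mat ** (rel_unitary' :: ('n free_star_alg)^'n^'n))"
    by simp
  then show ?thesis
    by (simp add: balanced_mult_left [OF f] balanced_mult_right [OF f] rel_in_I)
qed

lemma balanced_rel_twisted:
  assumes f: "balanced f"
  shows "map_matrix f (rel_twisted' Q) = map_matrix f (rel_twisted Q)"
proof -
  have "rel_twisted Q ** transpose u_mat = transpose u_mat ** rel_twisted' Q"
    by (simp add: rel_defs matrix_diff_ldistrib matrix_diff_rdistrib matrix_mul_assoc)
  then have "map_matrix f (rel_twisted Q ** transpose u_mat)
      = map_matrix f (transpose u_mat ** rel_twisted' Q)"
    by simp
  then show ?thesis
    by (simp add: balanced_mult_left [OF f] balanced_mult_right [OF f] rel_in_I)
qed

text \<open>In \<open>u\<^sup>t A v\<close> the entries of \<open>u\<close> stand to the left of those of \<open>v\<close>, as they do in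
  \<open>u u\<^sup>*\<close>. The scalars of \<open>A\<close> move freely, so that no commutation in the free algebra is needed
  and the traces are two arrangements of one triple sum.\<close>

lemma trace_identity:
  "trace (transpose u_mat ** const_mat A ** ubar_mat)
     = trace (const_mat (transpose A) ** (u_mat ** ustar_mat :: ('n free_star_alg)^'n^'n))"
proof -
  have "trace (transpose u_mat ** const_mat A ** ubar_mat)
      = (\<Sum>j\<in>UNIV. \<Sum>m\<in>UNIV. \<Sum>l\<in>UNIV.
           scalar_elem (A $ l $ m) * (gen_elem (U l j) * gen_elem (Ustar m j)))"
    by (simp add: trace_def matrix_matrix_mult_nth transpose_def sum_distrib_right
        scalar_elem_central mult.assoc)
  also have "\<dots> = (\<Sum>m\<in>UNIV. \<Sum>l\<in>UNIV. \<Sum>j\<in>UNIV.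
           scalar_elem (A $ l $ m) * (gen_elem (U l j) * gen_elem (Ustar m j)))"
    by (subst sum.swap, rule sum.cong [OF refl], rule sum.swap)
  also have "\<dots> = trace (const_mat (transpose A) ** (u_mat ** ustar_mat))"
    by (simp add: trace_def matrix_matrix_mult_nth transpose_def sum_distrib_left)
  finally show ?thesis .
qed

lemma trace_identity':
  "trace (ubar_mat ** const_mat A ** transpose u_mat)
     = trace (const_mat (transpose A) ** (ustar_mat ** u_mat :: ('n free_star_alg)^'n^'n))"
proof -
  have "trace (ubar_mat ** const_mat A ** transpose u_mat)
      = (\<Sum>j\<in>UNIV. \<Sum>m\<in>UNIV. \<Sum>l\<in>UNIV.
           scalar_elem (A $ l $ m) * (gen_elem (Ustar j l) * gen_elem (U j m)))"
    by (simp add: trace_def matrix_matrix_mult_nth transpose_def sum_distrib_right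
        scalar_elem_central mult.assoc)
  also have "\<dots> = (\<Sum>m\<in>UNIV. \<Sum>l\<in>UNIV. \<Sum>j\<in>UNIV.
           scalar_elem (A $ l $ m) * (gen_elem (Ustar j l) * gen_elem (U j m)))"
    by (subst sum.swap, rule sum.cong [OF refl], rule sum.swap)
  also have "\<dots> = trace (const_mat (transpose A) ** (ustar_mat ** u_mat))"
    by (simp add: trace_def matrix_matrix_mult_nth transpose_def sum_distrib_left)
  finally show ?thesis .
qed

lemma trace_map_matrix: "linear_fun f \<Longrightarrow> trace (map_matrix f M) = f (trace M)"
  by (simp add: trace_def linear_fun_sum)

lemma trace_const_transpose: "trace (const_mat (transpose A)) = trace (const_mat A)"
  by (simp add: trace_def transpose_def)

lemma trace_rel_twisted:
  assumes f: "linear_fun f"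
  shows "trace (map_matrix f (rel_twisted Q) ** Q)
       = trace (transpose Q ** map_matrix f (rel_unitary :: ('n free_star_alg)^'n^'n))"
proof -
  have "trace (rel_twisted Q ** const_mat Q)
      = trace (const_mat (transpose Q) ** (rel_unitary :: ('n free_star_alg)^'n^'n))"
    by (simp add: rel_defs matrix_inv_eq matrix_diff_ldistrib matrix_diff_rdistrib trace_diff
        const_inverse trace_const_transpose trace_identity [symmetric] flip: matrix_mul_assoc)
  then have "f (trace (rel_twisted Q ** const_mat Q))
      = f (trace (const_mat (transpose Q) ** (rel_unitary :: ('n free_star_alg)^'n^'n)))"
    by simp
  then show ?thesis
    by (simp add: map_matrix_const_mult map_matrix_mult_const f flip: trace_map_matrix [OF f])
qed

lemma trace_rel_twisted':
  assumes f: "linear_fun f"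
  shows "trace (P ** map_matrix f (rel_twisted' Q))
       = trace (transpose P ** map_matrix f (rel_unitary' :: ('n free_star_alg)^'n^'n))"
proof -
  have "trace (const_mat P ** rel_twisted' Q)
      = trace (const_mat (transpose P) ** (rel_unitary' :: ('n free_star_alg)^'n^'n))"
    by (simp add: rel_defs matrix_inv_eq matrix_diff_ldistrib matrix_diff_rdistrib trace_diff
        const_inverse_left trace_const_transpose trace_identity' [symmetric] flip: matrix_mul_assoc)
  then have "f (trace (const_mat P ** rel_twisted' Q))
      = f (trace (const_mat (transpose P) ** (rel_unitary' :: ('n free_star_alg)^'n^'n)))"
    by simp
  then show ?thesis
    by (simp add: map_matrix_const_mult map_matrix_mult_const f flip: trace_map_matrix [OF f])
qed

text \<open>The matrix of values on the twisted relation, after a derivation has been subtracted that makes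
  the values on the unitarity relation zero.\<close>

definition obstruction :: "('n free_star_alg \<Rightarrow> complex) \<Rightarrow> complex^'n^'n" where
  "obstruction f = map_matrix f (rel_twisted Q) - Q ** transpose (map_matrix f rel_unitary) ** P"

lemma trace_obstruction:
  assumes f: "balanced f"
  shows "trace (obstruction f ** Q) = 0" "trace (obstruction f ** P) = 0"
proof -
  let ?B = "map_matrix f (rel_unitary :: ('n free_star_alg)^'n^'n)"
  let ?C = "map_matrix f (rel_twisted Q)"
  note lin = balanced_linear [OF f]
  have "trace (obstruction f ** Q) = trace (?C ** Q) - trace (Q ** transpose ?B)"
    by (simp add: obstruction_def matrix_diff_rdistrib trace_diff inverse flip: matrix_mul_assoc)
  also have "\<dots> = 0"
    using trace_rel_twisted [OF lin] by (simp add: trace_transpose_mult)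
  finally show "trace (obstruction f ** Q) = 0" .
  have "trace (obstruction f ** P) = trace (P ** obstruction f)"
    by (rule trace_mul_sym)
  also have "\<dots> = trace (P ** ?C) - trace (transpose ?B ** P)"
    by (simp add: obstruction_def matrix_diff_ldistrib trace_diff inverse matrix_mul_assoc)
  also have "\<dots> = 0"
    using trace_rel_twisted' [OF lin]
    by (simp add: trace_transpose_mult trace_mul_sym [of "transpose ?B"]
        balanced_rel_unitary [OF f] balanced_rel_twisted [OF f])
  finally show "trace (obstruction f ** P) = 0" .
qed

lemma obstruction_add: "obstruction (\<lambda>x. f x + g x) = obstruction f + obstruction g"
proof -
  have "map_matrix (\<lambda>x. f x + g x) M = map_matrix f M + map_matrix g M"
    for M :: "('n free_star_alg)^'n^'n"
    by (simp add: mat_eq_iff)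
  then show ?thesis
    by (simp add: obstruction_def transpose_add matrix_add_ldistrib matrix_add_rdistrib)
qed

lemma obstruction_scale: "obstruction (\<lambda>x. a * f x) = map_matrix ((*) a) (obstruction f)"
  by (simp add: obstruction_def mat_eq_iff matrix_matrix_mult_nth transpose_def sum_distrib_left
      sum_distrib_right algebra_simps)

lemma obstruction_diff: "obstruction (\<lambda>x. f x - g x) = obstruction f - obstruction g"
  using obstruction_add [of "\<lambda>x. f x - g x" g] by simp

text \<open>The zeros of a balanced functional in \<open>I\<close> form an ideal.\<close>

lemma balanced_eq_zero:
  assumes f: "balanced f"
    and rel: "map_matrix f (rel_unitary :: ('n free_star_alg)^'n^'n) = 0"
      "map_matrix f (rel_twisted Q) = 0"
    and r: "r \<in> I"
  shows "f r = 0"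
proof -
  note lin = balanced_linear [OF f]
  have "I \<subseteq> {r \<in> I. f r = 0}"
  proof (rule I_subset)
    show "two_sided_ideal {r \<in> I. f r = 0}"
      using f I_closed
      by (simp add: two_sided_ideal_def balanced_def linear_fun_zero [OF lin] linear_fun_add [OF lin])
    have *: "entries_in {r \<in> I. f r = 0} R" if "map_matrix f R = 0" "entries_in I R"
      for R :: "('n free_star_alg)^'n^'n"
      using that by (simp add: entries_in_def mat_eq_iff)
    show "entries_in {r \<in> I. f r = 0} rel_unitary" "entries_in {r \<in> I. f r = 0} rel_unitary'"
      "entries_in {r \<in> I. f r = 0} (rel_twisted Q)" "entries_in {r \<in> I. f r = 0} (rel_twisted' Q)"
      by (rule *; simp add: rel rel_in_I balanced_rel_unitary [OF f] balanced_rel_twisted [OF f])+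
  qed
  then show ?thesis
    using r by blast
qed

subsection \<open>Derivations\<close>

abbreviation derivation :: "('n free_star_alg \<Rightarrow> complex) \<Rightarrow> bool" where
  "derivation \<equiv> primitive (\<lambda>x y. 0)"

lemma derivation_exists: "\<exists>\<delta>. derivation \<delta> \<and> map_matrix \<delta> u_mat = X \<and> map_matrix \<delta> ubar_mat = Y"
proof -
  have "(\<lambda>x y. 0) \<in> (free_cocycles :: ('n free_star_alg \<Rightarrow> 'n free_star_alg \<Rightarrow> complex) set)"
    by (simp add: free_cocycles_iff linear_fun_const_0)
  from free_cocycle_primitive [OF this, of "case_gen (\<lambda>j k. X $ j $ k) (\<lambda>j k. Y $ j $ k)"]
  obtain \<delta> where "derivation \<delta>"
    and "\<forall>g. \<delta> (gen_elem g) = (case g of U j k \<Rightarrow> X $ j $ k | Ustar j k \<Rightarrow> Y $ j $ k)"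
    by blast
  then show ?thesis
    by (intro exI [of _ \<delta>]) (simp add: mat_eq_iff)
qed

lemma map_matrix_derivation_mult:
  assumes d: "derivation \<delta>"
  shows "map_matrix \<delta> (M ** N)
       = map_matrix free_counit M ** map_matrix \<delta> N + map_matrix \<delta> M ** map_matrix free_counit N"
proof -
  have lin: "linear_fun \<delta>"
    using d by (simp add: primitive_def)
  show ?thesis
    using d by (simp add: mat_eq_iff matrix_matrix_mult_nth linear_fun_sum [OF lin] primitive_def
        sum.distrib)
qed

text \<open>A derivation may take arbitrary values \<open>X\<close> on \<open>u\<close> and \<open>Y\<close> on \<open>v\<close>. The
  choice of \<open>Y\<close> serves to normalise the values on the unitarity relation, and the obstruction matrix
  is made insensitive to it; only \<open>X\<close> remains visible.\<close>

lemma
  assumes d: "derivation \<delta>" "map_matrix \<delta> u_mat = X" "map_matrix \<delta> ubar_mat = Y"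
  shows derivation_rel_unitary:
      "map_matrix \<delta> (rel_unitary :: ('n free_star_alg)^'n^'n) = X + transpose Y"
    and derivation_rel_twisted: "map_matrix \<delta> (rel_twisted Q) = transpose X + Q ** Y ** P"
    and obstruction_derivation: "obstruction \<delta> = transpose X - Q ** transpose X ** P"
proof -
  have lin: "linear_fun \<delta>"
    using d(1) by (simp add: primitive_def)
  have "\<delta> (x * y) = free_counit x * \<delta> y + \<delta> x * free_counit y" for x y
    using d(1) by (simp add: primitive_def)
  from this [of 1 1] have "\<delta> 1 = 0"
    by simp
  then have const: "map_matrix \<delta> (const_mat A) = 0" for A :: "complex^'n^'n"
    using linear_fun_scale [OF lin, of _ 1] by (simp add: mat_eq_iff)
  from this [of "mat 1"] have one: "map_matrix \<delta> (mat 1 :: ('n free_star_alg)^'n^'n) = 0"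
    by (simp add: const_mat_one)
  show 1: "map_matrix \<delta> (rel_unitary :: ('n free_star_alg)^'n^'n) = X + transpose Y"
    by (simp add: rel_defs map_matrix_diff [OF lin] map_matrix_derivation_mult [OF d(1)] one
        map_matrix_ustar d(2,3))
  show 2: "map_matrix \<delta> (rel_twisted Q) = transpose X + Q ** Y ** P"
    by (simp add: rel_defs matrix_inv_eq map_matrix_diff [OF lin] one const map_matrix_mult_const [OF lin]
        map_matrix_derivation_mult [OF d(1)] map_matrix_transpose d(2,3) inverse
        map_matrix_const_mult [OF lin] matrix_add_rdistrib map_matrix_counit_mult
        flip: matrix_mul_assoc)
  show "obstruction \<delta> = transpose X - Q ** transpose X ** P"
    by (simp add: obstruction_def 1 2 transpose_add matrix_add_ldistrib matrix_add_rdistrib)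
qed


section \<open>Cocycles of the quotient as balanced functionals\<close>

abbreviation "Z2 \<equiv> hochschild_cocycles2 (Au Q) Au_counit"
abbreviation "B2 \<equiv> hochschild_coboundaries2 (Au Q) Au_counit"

definition pullback :: "('n free_star_alg set \<Rightarrow> 'n free_star_alg set \<Rightarrow> complex) \<Rightarrow>
    'n free_star_alg \<Rightarrow> 'n free_star_alg \<Rightarrow> complex" where
  "pullback c x y = c (proj x) (proj y)"

lemma lin_functional_Au: "lin_functional (Au Q) g \<longleftrightarrow> linear_fun (\<lambda>x. g (proj x))"
  by (auto simp: lin_functional_def Au_simps)

lemma Z2_iff:
  "c \<in> Z2 \<longleftrightarrow> pullback c \<in> free_cocycles \<and>
     (\<forall>X Y. X \<notin> range proj \<or> Y \<notin> range proj \<longrightarrow> c X Y = 0)"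
proof -
  have "pullback c = (\<lambda>x y. c (proj x) (proj y))"
    by (simp add: fun_eq_iff pullback_def)
  then show ?thesis
    by (simp add: hochschild_cocycles2_def free_cocycles_iff Au_simps lin_functional_Au conj_ac)
qed

lemma pullback_I:
  assumes c: "c \<in> Z2" and r: "r \<in> I"
  shows "pullback c r x = 0" "pullback c x r = 0"
proof -
  have "linear_fun (pullback c x)" "linear_fun (\<lambda>x. pullback c x y)" for x y
    using c by (auto simp: Z2_iff free_cocycles_iff)
  then have "pullback c x 0 = 0" "pullback c 0 x = 0"
    by (auto dest: linear_fun_zero)
  moreover have "proj r = proj 0"
    using r by (simp add: proj_eq_iff)
  ultimately show "pullback c r x = 0" "pullback c x r = 0"
    by (simp_all add: pullback_def)
qed

lemma primitive_pullback_balanced: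
  assumes c: "c \<in> Z2" and "primitive (pullback c) \<psi>"
  shows "balanced \<psi>"
  using assms by (simp add: balanced_def primitive_def pullback_I counit_I)

lemma primitive_pullback_exists:
  assumes "c \<in> Z2"
  shows "\<exists>\<psi>. primitive (pullback c) \<psi>"
proof -
  have "pullback c \<in> free_cocycles"
    using assms by (simp add: Z2_iff)
  from free_cocycle_primitive [OF this, of "\<lambda>g. 0"] show ?thesis
    by auto
qed

definition rep :: "'n free_star_alg set \<Rightarrow> 'n free_star_alg" where
  "rep X = (SOME x. proj x = X)"

lemma rep_proj: "rep (proj x) - x \<in> I"
  unfolding rep_def by (rule someI2 [of _ x]) (auto simp flip: proj_eq_iff)

lemma vanishing_rep_proj:
  assumes f: "linear_fun f" "\<And>r. r \<in> I \<Longrightarrow> f r = 0"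
  shows "f (rep (proj x)) = f x"
  using f(2) [OF rep_proj [of x]] by (simp add: linear_fun_diff [OF f(1)])

text \<open>A primitive that vanishes on \<open>I\<close> is constant on cosets, and so is a primitive of the cocycle
  on the quotient.\<close>

lemma B2_iff:
  assumes c: "c \<in> Z2"
  shows "c \<in> B2 \<longleftrightarrow> (\<exists>\<psi>. primitive (pullback c) \<psi> \<and> (\<forall>r\<in>I. \<psi> r = 0))"
proof
  assume "c \<in> B2"
  then obtain g where g: "linear_fun (\<lambda>x. g (proj x))" and c': "c = hochschild_d1 (Au Q) Au_counit g"
    by (auto simp: hochschild_coboundaries2_def lin_functional_Au)
  have "g (proj r) = 0" if "r \<in> I" for r
  proof -
    have "proj r = proj 0"
      using that by (simp add: proj_eq_iff)
    then show ?thesis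
      using linear_fun_zero [OF g] by simp
  qed
  moreover have "primitive (pullback c) (\<lambda>x. g (proj x))"
    using g by (simp add: primitive_def pullback_def c' hochschild_d1_def Au_simps)
  ultimately show "\<exists>\<psi>. primitive (pullback c) \<psi> \<and> (\<forall>r\<in>I. \<psi> r = 0)"
    by blast
next
  assume "\<exists>\<psi>. primitive (pullback c) \<psi> \<and> (\<forall>r\<in>I. \<psi> r = 0)"
  then obtain \<psi> where \<psi>: "primitive (pullback c) \<psi>" and zero: "\<And>r. r \<in> I \<Longrightarrow> \<psi> r = 0"
    by blast
  have lin: "linear_fun \<psi>"
    using \<psi> by (simp add: primitive_def)
  note eq = vanishing_rep_proj [OF lin zero]
  have "c X Y = hochschild_d1 (Au Q) Au_counit (\<lambda>X. \<psi> (rep X)) X Y" for X Y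
  proof (cases "X \<in> range proj \<and> Y \<in> range proj")
    case True
    then obtain x y where "X = proj x" "Y = proj y"
      by blast
    moreover have "\<psi> (x * y) = free_counit x * \<psi> y + \<psi> x * free_counit y - c (proj x) (proj y)"
      using \<psi> by (simp add: primitive_def pullback_def)
    ultimately show ?thesis
      by (simp add: hochschild_d1_def Au_simps eq)
  next
    case False
    then have "c X Y = 0"
      using c unfolding Z2_iff by blast
    then show ?thesis
      using False by (auto simp: hochschild_d1_def Au_simps)
  qed
  moreover have "lin_functional (Au Q) (\<lambda>X. \<psi> (rep X))"
    using lin by (simp add: lin_functional_Au eq)
  ultimately show "c \<in> B2"
    unfolding hochschild_coboundaries2_def by blast
qed

text \<open>The coboundary of \<open>f\<close> depends on the cosets only, by balancedness, although \<open>f\<close> does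
  not.\<close>

definition descend :: "('n free_star_alg \<Rightarrow> complex) \<Rightarrow>
    'n free_star_alg set \<Rightarrow> 'n free_star_alg set \<Rightarrow> complex" where
  "descend f X Y = (if X \<in> range proj \<and> Y \<in> range proj
     then free_counit (rep X) * f (rep Y) + f (rep X) * free_counit (rep Y) - f (rep X * rep Y)
     else 0)"

lemma pullback_descend:
  assumes f: "balanced f"
  shows "pullback (descend f) x y = free_counit x * f y + f x * free_counit y - f (x * y)"
proof -
  note lin = balanced_linear [OF f]
  define r s where "r = rep (proj x) - x" and "s = rep (proj y) - y"
  then have r: "r \<in> I" "rep (proj x) = x + r" and s: "s \<in> I" "rep (proj y) = y + s"
    using rep_proj [of x] rep_proj [of y] by simp_all
  have "f (r * s) = 0"
    using f r s by (simp add: balanced_def counit_I)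
  then show ?thesis
    using f r s
    by (simp add: pullback_def descend_def counit_I linear_fun_add [OF lin] balanced_def algebra_simps)
qed

lemma descend_in_Z2:
  assumes f: "balanced f"
  shows "descend f \<in> Z2" and "primitive (pullback (descend f)) f"
proof -
  note lin = balanced_linear [OF f]
  have "pullback (descend f) = (\<lambda>x y. free_counit x * f y + f x * free_counit y - f (x * y))"
    by (simp add: fun_eq_iff pullback_descend [OF f])
  then have "pullback (descend f) \<in> free_cocycles"
    by (auto simp: free_cocycles_iff algebra_simps
        intro!: linear_fun_intros lin linear_fun_free_counit)
  then show "descend f \<in> Z2"
    by (simp add: Z2_iff) (simp add: descend_def)
  show "primitive (pullback (descend f)) f"
    by (simp add: primitive_def lin pullback_descend [OF f])
qed

end


context hermitian_invertible
begin

section \<open>Realisable obstruction matrices\<close>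

definition realisable :: "complex^'n^'n \<Rightarrow> bool" where
  "realisable B \<longleftrightarrow> (\<exists>f. balanced f \<and> obstruction f = B)"

lemma realisable_zero: "realisable 0"
proof -
  have "balanced (\<lambda>x. 0)"
    by (simp add: balanced_def linear_fun_const_0)
  moreover have "obstruction (\<lambda>x. 0) = 0"
    using obstruction_diff [of "\<lambda>x. 0" "\<lambda>x. 0"] by simp
  ultimately show ?thesis
    unfolding realisable_def by blast
qed

lemma realisable_add:
  assumes "realisable A" "realisable B"
  shows "realisable (A + B)"
proof -
  obtain f g where f: "balanced f" "obstruction f = A" and g: "balanced g" "obstruction g = B"
    using assms unfolding realisable_def by blast
  have "balanced (\<lambda>x. f x + g x)"
    using f(1) g(1) by (simp add: balanced_def linear_fun_plus algebra_simps)
  then show ?thesis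
    unfolding realisable_def using f(2) g(2) obstruction_add [of f g] by metis
qed

lemma realisable_scale:
  assumes "realisable A"
  shows "realisable (map_matrix ((*) a) A)"
proof -
  obtain f where f: "balanced f" "obstruction f = A"
    using assms unfolding realisable_def by blast
  have "balanced (\<lambda>x. a * f x)"
    using f(1) by (simp add: balanced_def linear_fun_cmult)
  then show ?thesis
    unfolding realisable_def using f(2) obstruction_scale [of a f] by metis
qed

lemma realisable_sum: "(\<And>i. i \<in> K \<Longrightarrow> realisable (h i)) \<Longrightarrow> realisable (\<Sum>i\<in>K. h i)"
  by (induction K rule: infinite_finite_induct) (simp_all add: realisable_zero realisable_add)

end

subsection \<open>Triangular representations\<close>

text \<open>The matrices \<open>x a b\<close> and \<open>y a b\<close> are the \<open>(a, b)\<close> blocks of \<open>u\<^sup>t\<close> and of \<open>v\<close>.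
  Recording \<open>u\<close> in transposed form turns the twisted relations into plain block products.\<close>

fun tri_gen :: "(nat \<Rightarrow> nat \<Rightarrow> complex^'n^'n) \<Rightarrow> (nat \<Rightarrow> nat \<Rightarrow> complex^'n^'n) \<Rightarrow>
    'n::finite gen \<Rightarrow> nat \<Rightarrow> nat \<Rightarrow> complex" where
  "tri_gen x y (U j k) a b = x a b $ k $ j"
| "tri_gen x y (Ustar j k) a b = y a b $ j $ k"

fun tri_word :: "('n gen \<Rightarrow> nat \<Rightarrow> nat \<Rightarrow> complex) \<Rightarrow> 'n gen list \<Rightarrow> nat \<Rightarrow> nat \<Rightarrow> complex" where
  "tri_word t [] a b = (if a = b then 1 else 0)"
| "tri_word t (g # w) a b = (\<Sum>c<4. t g a c * tri_word t w c b)"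

definition coeff :: "('n gen \<Rightarrow> nat \<Rightarrow> nat \<Rightarrow> complex) \<Rightarrow> nat \<Rightarrow> nat \<Rightarrow> 'n free_star_alg \<Rightarrow> complex" where
  "coeff t a b = lin_ext (\<lambda>w. tri_word t w a b)"

lemma sum_lessThan_4: "(\<Sum>c<(4::nat). h c) = h 0 + h 1 + h 2 + h 3"
  by (simp add: eval_nat_numeral add.assoc)

lemma less_4_iff: "a < (4::nat) \<longleftrightarrow> a = 0 \<or> a = 1 \<or> a = 2 \<or> a = 3"
  by auto

lemma linear_fun_coeff: "linear_fun (coeff t a b)"
  unfolding coeff_def by (rule linear_fun_lin_ext)

lemma tri_word_append:
  assumes "a < 4"
  shows "tri_word t (v @ w) a b = (\<Sum>c<4. tri_word t v a c * tri_word t w c b)"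
  using assms
proof (induction v arbitrary: a)
  case Nil
  have "(\<Sum>c<4. (if a = c then 1 else 0) * tri_word t w c b)
      = (\<Sum>c<4. if a = c then tri_word t w c b else 0)"
    by (rule sum.cong) auto
  then show ?case
    using Nil by simp
next
  case (Cons g v)
  have "tri_word t ((g # v) @ w) a b
      = (\<Sum>d<4. t g a d * (\<Sum>c<4. tri_word t v d c * tri_word t w c b))"
    using Cons.IH by simp
  also have "\<dots> = (\<Sum>c<4. \<Sum>d<4. t g a d * tri_word t v d c * tri_word t w c b)"
    by (subst sum.swap) (simp add: sum_distrib_left mult.assoc)
  finally show ?case
    by (simp add: sum_distrib_right)
qed

lemma coeff_times: "a < 4 \<Longrightarrow> coeff t a b (x * y) = (\<Sum>c<4. coeff t a c x * coeff t c b y)"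
  unfolding coeff_def by (rule lin_ext_times) (rule tri_word_append)

lemma coeff_one: "coeff t a b 1 = (if a = b then 1 else 0)"
  by (simp add: coeff_def lin_ext_one)

lemma coeff_gen: "b < 4 \<Longrightarrow> coeff t a b (gen_elem g) = t g a b"
proof -
  assume "b < 4"
  have "(\<Sum>c<4. t g a c * (if c = b then 1 else 0)) = (\<Sum>c<4. if c = b then t g a c else 0)"
    by (rule sum.cong) auto
  then show ?thesis
    using \<open>b < 4\<close> by (simp add: coeff_def)
qed

lemma coeff_lower:
  assumes "\<And>g a b. b < a \<Longrightarrow> t g a b = 0" and "b < a"
  shows "coeff t a b x = 0"
proof -
  have "tri_word t w a b = 0" if "b < a" for w a b
    using that
  proof (induction w arbitrary: a)
    case (Cons g w)
    have "t g a c * tri_word t w c b = 0" for c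
      using assms(1) Cons by (cases "c < a") auto
    then show ?case
      by (simp only: tri_word.simps sum.neutral_const)
  qed simp
  then show ?thesis
    using assms(2) by (rule_tac linear_fun_eqI [of "coeff t a b" "\<lambda>x. 0"])
      (simp_all add: linear_fun_coeff linear_fun_const_0, simp add: coeff_def)
qed

lemma coeff_diagonal:
  assumes "\<And>g a b. b < a \<Longrightarrow> t g a b = 0" and "a < 4" and "\<And>g. t g a a = gen_counit g"
  shows "coeff t a a x = free_counit x"
proof -
  have "tri_word t w a a = word_counit w" for w
  proof (induction w)
    case (Cons g w)
    have low: "tri_word t w c a = 0" if "a < c" for c
      using coeff_lower [where x = "Poly_Mapping.single (Word w) 1", OF assms(1) that]
      by (simp add: coeff_def)
    have "(\<Sum>c<4. t g a c * tri_word t w c a) = (\<Sum>c<4. if c = a then gen_counit g * word_counit w else 0)"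
    proof (rule sum.cong [OF refl])
      fix c
      show "t g a c * tri_word t w c a = (if c = a then gen_counit g * word_counit w else 0)"
        using assms(1,3) low Cons by (cases c a rule: linorder_cases) auto
    qed
    then show ?case
      using assms(2) by simp
  qed simp
  then show ?thesis
    by (rule_tac linear_fun_eqI [of "coeff t a a" free_counit])
      (simp_all add: linear_fun_coeff linear_fun_free_counit,
        simp add: coeff_def free_counit_eq_lin_ext)
qed

lemma map_matrix_coeff_mult:
  "a < 4 \<Longrightarrow> map_matrix (coeff t a b) (M ** N)
     = (\<Sum>c<4. map_matrix (coeff t a c) M ** map_matrix (coeff t c b) N)"
  by (simp add: mat_eq_iff matrix_matrix_mult_nth linear_fun_sum [OF linear_fun_coeff] coeff_times)
    (intro allI sum.swap)

lemma transpose_mult: "transpose A ** transpose B = transpose (B ** (A :: complex^'n^'n))"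
  by (simp add: matrix_transpose_mul)

context hermitian_invertible
begin

text \<open>The elements whose image is supported in the corner form an ideal, because the image of \<open>F\<close>
  is triangular; it contains \<open>I\<close> as soon as it contains the relations. On such an element \<open>r\<close>,
  the corner of \<open>x r\<close> is \<open>\<epsilon> x\<close> times that of \<open>r\<close>, since a triangular matrix acts on the
  corner unit through its first diagonal entry; likewise for \<open>r x\<close>. In the unitarity relations the two factors of each block product appear in reverse order, since there
  \<open>x\<close> has to be transposed back.\<close>

lemma realisable_triangular:
  fixes x y :: "nat \<Rightarrow> nat \<Rightarrow> complex^'n^'n"
  assumes lower: "\<And>a b. b < a \<Longrightarrow> x a b = 0" "\<And>a b. b < a \<Longrightarrow> y a b = 0"
    and ends: "x 0 0 = mat 1" "y 0 0 = mat 1" "x 3 3 = mat 1" "y 3 3 = mat 1"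
    and unitary: "\<And>a b. a < 4 \<Longrightarrow> b < 4 \<Longrightarrow>
        (\<Sum>c<4. y c b ** x a c) = (if a = b then mat 1 else 0)"
    and unitary': "\<And>a b. a < 4 \<Longrightarrow> b < 4 \<Longrightarrow>
        (\<Sum>c<4. x c b ** y a c) = (if a = b then mat 1 else 0)"
    and twisted: "\<And>a b. a < 4 \<Longrightarrow> b < 4 \<Longrightarrow>
        (\<Sum>c<4. x a c ** Q ** y c b) = (if a = b then Q else 0) + (if a = 0 \<and> b = 3 then B ** Q else 0)"
    and twisted': "\<And>a b. a < 4 \<Longrightarrow> b < 4 \<Longrightarrow>
        (\<Sum>c<4. y a c ** P ** x c b) = (if a = b then P else 0) + (if a = 0 \<and> b = 3 then P ** B else 0)"
  shows "realisable B"
proof -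
  let ?t = "tri_gen x y"
  let ?c = "\<lambda>a b. map_matrix (coeff ?t a b)"
  have low: "coeff ?t a b z = 0" if "b < a" for a b z
  proof (rule coeff_lower [OF _ that])
    show "?t g a b = 0" if "b < a" for g a b
      using lower [OF that] by (cases g) simp_all
  qed
  have diag: "coeff ?t a a z = free_counit z" if "a = 0 \<or> a = 3" for a z
  proof (rule coeff_diagonal)
    show "?t g a b = 0" if "b < a" for g a b
      using lower [OF that] by (cases g) simp_all
    show "?t g a a = gen_counit g" for g
      using that ends by (cases g) (auto simp: mat_def)
  qed (use that in auto)
  have gens: "?c a b (transpose u_mat) = x a b" "?c a b u_mat = transpose (x a b)"
    "?c a b ubar_mat = y a b" "?c a b ustar_mat = transpose (y a b)" if "b < 4" for a b
    using that by (simp_all add: mat_eq_iff transpose_def coeff_gen)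
  have one: "?c a b (mat 1 :: ('n free_star_alg)^'n^'n) = (if a = b then mat 1 else 0)" for a b
    by (simp add: mat_eq_iff mat_def coeff_one linear_fun_zero [OF linear_fun_coeff])
  note lin = map_matrix_diff [OF linear_fun_coeff] map_matrix_const_mult [OF linear_fun_coeff]
    map_matrix_mult_const [OF linear_fun_coeff]
  have r1: "?c a b (rel_unitary :: ('n free_star_alg)^'n^'n) = 0" if "a < 4" "b < 4" for a b
  proof -
    have "?c a b (u_mat ** ustar_mat :: ('n free_star_alg)^'n^'n)
        = transpose (\<Sum>c<4. y c b ** x a c)"
      using that by (simp add: map_matrix_coeff_mult gens transpose_mult transpose_sum)
    then show ?thesis
      using that by (cases "a = b") (simp_all add: rel_defs lin one unitary transpose_zero)
  qed
  have r2: "?c a b (rel_unitary' :: ('n free_star_alg)^'n^'n) = 0" if "a < 4" "b < 4" for a b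
  proof -
    have "?c a b (ustar_mat ** u_mat :: ('n free_star_alg)^'n^'n)
        = transpose (\<Sum>c<4. x c b ** y a c)"
      using that by (simp add: map_matrix_coeff_mult gens transpose_mult transpose_sum)
    then show ?thesis
      using that by (cases "a = b") (simp_all add: rel_defs lin one unitary' transpose_zero)
  qed
  have r3: "?c a b (rel_twisted Q) = (if a = 0 \<and> b = 3 then B else 0)" if "a < 4" "b < 4" for a b
  proof -
    have "?c a b (transpose u_mat ** const_mat Q ** ubar_mat) = (\<Sum>c<4. x a c ** Q ** y c b)"
      using that by (simp add: map_matrix_coeff_mult gens lin)
    then have "?c a b (rel_twisted Q) = ((if a = b then Q else 0)
        + (if a = 0 \<and> b = 3 then B ** Q else 0)) ** P - (if a = b then mat 1 else 0)"
      using that by (simp only: rel_twisted_def matrix_inv_eq lin one twisted)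
    moreover have "B ** Q ** P = B"
      by (simp add: inverse flip: matrix_mul_assoc)
    ultimately show ?thesis
      by (auto simp: inverse matrix_add_rdistrib)
  qed
  have r4: "?c a b (rel_twisted' Q) = (if a = 0 \<and> b = 3 then B else 0)" if "a < 4" "b < 4" for a b
  proof -
    have "?c a b (const_mat Q ** (ubar_mat ** const_mat P ** transpose u_mat))
        = Q ** (\<Sum>c<4. y a c ** P ** x c b)"
      using that by (simp add: map_matrix_coeff_mult gens lin)
    then show ?thesis
      using that
      by (simp add: rel_defs matrix_inv_eq lin one twisted' matrix_mul_assoc)
        (auto simp: inverse matrix_add_ldistrib matrix_mul_assoc)
  qed
  let ?J = "{z. \<forall>a<4. \<forall>b<4. (a, b) \<noteq> (0, 3) \<longrightarrow> coeff ?t a b z = 0}"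
  have "I \<subseteq> ?J"
  proof (rule I_subset)
    have "coeff ?t a b (z * r) = 0" "coeff ?t a b (r * z) = 0"
      if r: "r \<in> ?J" and ab: "a < 4" "b < 4" "(a, b) \<noteq> (0, 3)" for a b r z
    proof -
      have left: "coeff ?t a c z * coeff ?t c b r = 0" if "c < 4" for c
        using r ab that low [of c a z] by (cases "(c, b) = (0, 3)") auto
      show "coeff ?t a b (z * r) = 0"
        unfolding coeff_times [OF ab(1)] by (intro sum.neutral ballI, rule left) simp
      have right: "coeff ?t a c r * coeff ?t c b z = 0" if "c < 4" for c
        using r ab that low [of b c z] by (cases "(a, c) = (0, 3)") auto
      show "coeff ?t a b (r * z) = 0"
        unfolding coeff_times [OF ab(1)] by (intro sum.neutral ballI, rule right) simp
    qed
    then show "two_sided_ideal ?J"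
      by (auto simp: two_sided_ideal_def linear_fun_zero [OF linear_fun_coeff]
          linear_fun_add [OF linear_fun_coeff])
    have *: "entries_in ?J R" if "\<And>a b. a < 4 \<Longrightarrow> b < 4 \<Longrightarrow> (a, b) \<noteq> (0, 3) \<Longrightarrow> ?c a b R = 0"
      for R :: "('n free_star_alg)^'n^'n"
      using that by (auto simp: entries_in_def mat_eq_iff)
    show "entries_in ?J rel_unitary" "entries_in ?J rel_unitary'"
      "entries_in ?J (rel_twisted Q)" "entries_in ?J (rel_twisted' Q)"
      by (rule *; auto simp: r1 r2 r3 r4)+
  qed
  then have van: "coeff ?t a b r = 0" if "r \<in> I" "a < 4" "b < 4" "(a, b) \<noteq> (0, 3)" for a b r
    using that by blast
  let ?f = "coeff ?t 0 3"
  have "balanced ?f"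
    unfolding balanced_def
  proof (intro conjI allI ballI linear_fun_coeff)
    fix z r
    assume r: "r \<in> I"
    show "?f (z * r) = free_counit z * ?f r" "?f (r * z) = ?f r * free_counit z"
      using van [OF r] diag counit_I [OF r] by (simp_all add: coeff_times sum_lessThan_4)
  qed
  moreover have "obstruction ?f = B"
    using r1 [of 0 3] r3 [of 0 3] by (simp add: obstruction_def transpose_def mat_eq_iff
        matrix_matrix_mult_nth)
  ultimately show ?thesis
    unfolding realisable_def by blast
qed

text \<open>With all diagonal characters equal to \<open>\<epsilon>\<close>, the matrices \<open>X\<close> and \<open>Y\<close> at the places
  \<open>(0, 1)\<close> and \<open>(1, 3)\<close> are the values of two derivations that vanish on \<open>I\<close>, and the
  corner is their cup product, normalised on the unitarity relation. The place \<open>2\<close> carries a direct summand that does not interact with the rest.\<close>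

lemma realisable_commutator:
  assumes X: "X ** Q = Q ** X" and Y: "Y ** Q = Q ** Y"
  shows "realisable (Y ** X - X ** Y)"
proof -
  have "P ** (Y ** Q) ** P = P ** (Q ** Y) ** P"
    by (simp add: Y)
  then have Y': "Y ** P = P ** Y"
    by (simp add: matrix_mul_assoc inverse) (simp add: inverse flip: matrix_mul_assoc)
  have "P ** (X ** Q) ** P = P ** (Q ** X) ** P"
    by (simp add: X)
  then have X': "X ** P = P ** X"
    by (simp add: matrix_mul_assoc inverse) (simp add: inverse flip: matrix_mul_assoc)
  let ?x = "\<lambda>a b. if a = b then mat 1 else if a = 0 \<and> b = 1 then X
      else if a = 1 \<and> b = (3::nat) then Y else (0 :: complex^'n^'n)"
  let ?y = "\<lambda>a b. if a = b then mat 1 else if a = 0 \<and> b = 1 then - X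
      else if a = 1 \<and> b = (3::nat) then - Y
      else if a = 0 \<and> b = (3::nat) then Y ** X else (0 :: complex^'n^'n)"
  have left: "X ** (Q ** Z) = Q ** (X ** Z)" "Y ** (Q ** Z) = Q ** (Y ** Z)"
    "X ** (P ** Z) = P ** (X ** Z)" "Y ** (P ** Z) = P ** (Y ** Z)" for Z
    by (simp_all only: matrix_mul_assoc X Y X' Y')
  show ?thesis
  proof (rule realisable_triangular [of ?x ?y])
    fix a b :: nat
    assume "a < 4" "b < 4"
    then have "a = 0 \<or> a = 1 \<or> a = 2 \<or> a = 3" "b = 0 \<or> b = 1 \<or> b = 2 \<or> b = 3"
      by (simp_all add: less_4_iff)
    then show "(\<Sum>c<4. ?y c b ** ?x a c) = (if a = b then mat 1 else 0)"
      "(\<Sum>c<4. ?x c b ** ?y a c) = (if a = b then mat 1 else 0)"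
      "(\<Sum>c<4. ?x a c ** Q ** ?y c b) = (if a = b then Q else 0)
         + (if a = 0 \<and> b = 3 then (Y ** X - X ** Y) ** Q else 0)"
      "(\<Sum>c<4. ?y a c ** P ** ?x c b) = (if a = b then P else 0)
         + (if a = 0 \<and> b = 3 then P ** (Y ** X - X ** Y) else 0)"
      unfolding sum_lessThan_4
      by (elim disjE; simp add: matrix_mult_lminus matrix_mult_rminus X Y X' Y' left
          matrix_diff_ldistrib matrix_diff_rdistrib flip: matrix_mul_assoc)+
  qed auto
qed

end


section \<open>Coordinates in an eigenbasis\<close>

text \<open>Positivity of the eigenvalues enters through the last two assumptions: distinct eigenvalues
  have distinct squares, so \<open>q i / q j\<close> differs from its inverse.\<close>

locale eigenbasis = hermitian_invertible Q P
  for Q P :: "complex^'n::finite^'n" +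
  fixes S T :: "complex^'n^'n" and q :: "'n \<Rightarrow> complex"
  assumes ST: "S ** T = mat 1" "T ** S = mat 1"
    and diagonal: "Q = S ** (\<chi> i j. if i = j then q i else 0) ** T"
    and q_nonzero: "q i \<noteq> 0"
    and q_square: "(q i)\<^sup>2 = (q j)\<^sup>2 \<Longrightarrow> q i = q j"
begin

definition of_coords :: "complex^'n^'n \<Rightarrow> complex^'n^'n" where
  "of_coords C = S ** C ** T"

definition coords :: "complex^'n^'n \<Rightarrow> complex^'n^'n" where
  "coords M = T ** M ** S"

definition unit :: "'n \<Rightarrow> 'n \<Rightarrow> complex \<Rightarrow> complex^'n^'n" where
  "unit i j a = of_coords (\<chi> r s. if r = i \<and> s = j then a else 0)"

definition dg :: "('n \<Rightarrow> complex) \<Rightarrow> complex^'n^'n" where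
  "dg f = of_coords (\<chi> r s. if r = s then f r else 0)"

lemma ST_left: "S ** (T ** M) = M" "T ** (S ** M) = M"
  by (simp_all add: matrix_mul_assoc ST)

lemma of_coords_coords [simp]: "of_coords (coords M) = M"
  by (simp add: of_coords_def coords_def ST ST_left flip: matrix_mul_assoc)

lemma coords_of_coords [simp]: "coords (of_coords C) = C"
  by (simp add: of_coords_def coords_def ST ST_left flip: matrix_mul_assoc)

lemma of_coords_mult: "of_coords C ** of_coords D = of_coords (C ** D)"
  by (simp add: of_coords_def ST_left flip: matrix_mul_assoc)

lemma of_coords_add: "of_coords C + of_coords D = of_coords (C + D)"
  by (simp add: of_coords_def matrix_add_ldistrib matrix_add_rdistrib)

lemma of_coords_minus: "- of_coords C = of_coords (- C)"
  by (simp add: of_coords_def matrix_mult_lminus matrix_mult_rminus)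

lemma of_coords_zero: "of_coords 0 = 0"
  by (simp add: of_coords_def)

lemma of_coords_scale: "map_matrix ((*) a) (of_coords C) = of_coords (map_matrix ((*) a) C)"
  by (simp add: of_coords_def mat_eq_iff matrix_matrix_mult_nth sum_distrib_left sum_distrib_right
      ac_simps)

lemma of_coords_sum: "(\<Sum>k\<in>K. of_coords (h k)) = of_coords (\<Sum>k\<in>K. h k)"
  by (induction K rule: infinite_finite_induct) (simp_all add: of_coords_zero of_coords_add)

lemma of_coords_eq_iff: "of_coords C = of_coords D \<longleftrightarrow> C = D"
  by (metis coords_of_coords)

lemma unit_mult: "unit i j a ** unit k l b = (if j = k then unit i l (a * b) else 0)"
proof -
  have "(\<Sum>t\<in>UNIV. (if r = i \<and> t = j then a else 0) * (if t = k \<and> s = l then b else 0))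
      = (\<Sum>t\<in>UNIV. if t = j then (if r = i \<and> j = k \<and> s = l then a * b else 0) else 0)" for r s
    by (rule sum.cong) auto
  then have "(\<chi> r s. if r = i \<and> s = j then a else 0) ** (\<chi> r s. if r = k \<and> s = l then b else 0)
      = (if j = k then (\<chi> r s. if r = i \<and> s = l then a * b else 0) else 0)"
    by (simp add: mat_eq_iff matrix_matrix_mult_nth)
  then show ?thesis
    by (simp add: unit_def of_coords_mult of_coords_zero)
qed

lemma dg_mult: "dg f ** dg g = dg (\<lambda>i. f i * g i)"
proof -
  have "(\<Sum>t\<in>UNIV. (if r = t then f r else 0) * (if t = s then g t else 0))
      = (\<Sum>t\<in>UNIV. if t = r then (if r = s then f r * g r else 0) else 0)" for r s
    by (rule sum.cong) auto
  then show ?thesis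
    unfolding dg_def of_coords_mult
    by (intro arg_cong [where f = of_coords]) (simp add: mat_eq_iff matrix_matrix_mult_nth)
qed

lemma dg_unit: "dg f ** unit i j a = unit i j (f i * a)"
proof -
  have "(\<Sum>t\<in>UNIV. (if r = t then f r else 0) * (if t = i \<and> s = j then a else 0))
      = (\<Sum>t\<in>UNIV. if t = r then (if r = i \<and> s = j then f i * a else 0) else 0)" for r s
    by (rule sum.cong) auto
  then show ?thesis
    unfolding dg_def unit_def of_coords_mult
    by (intro arg_cong [where f = of_coords]) (simp add: mat_eq_iff matrix_matrix_mult_nth)
qed

lemma unit_dg: "unit i j a ** dg f = unit i j (a * f j)"
proof -
  have "(\<Sum>t\<in>UNIV. (if r = i \<and> t = j then a else 0) * (if t = s then f t else 0))
      = (\<Sum>t\<in>UNIV. if t = s then (if r = i \<and> s = j then a * f j else 0) else 0)" for r s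
    by (rule sum.cong) auto
  then show ?thesis
    unfolding dg_def unit_def of_coords_mult
    by (intro arg_cong [where f = of_coords]) (simp add: mat_eq_iff matrix_matrix_mult_nth)
qed

lemma unit_add: "unit i j a + unit i j b = unit i j (a + b)"
  unfolding unit_def of_coords_add by (intro arg_cong [where f = of_coords]) (simp add: mat_eq_iff)

lemma unit_minus: "- unit i j a = unit i j (- a)"
  unfolding unit_def of_coords_minus by (intro arg_cong [where f = of_coords]) (simp add: mat_eq_iff)

lemma unit_eq_0_iff: "unit i j a = 0 \<longleftrightarrow> a = 0"
proof -
  have "unit i j a = 0 \<longleftrightarrow> (\<chi> r s. if r = i \<and> s = j then a else 0) = (0 :: complex^'n^'n)"
    using of_coords_eq_iff [of _ 0] by (simp add: unit_def of_coords_zero)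
  then show ?thesis
    by (auto simp: mat_eq_iff)
qed

lemma unit_diagonal: "unit i i a = dg (\<lambda>l. if l = i then a else 0)"
  unfolding unit_def dg_def by (intro arg_cong [where f = of_coords]) (auto simp: mat_eq_iff)

lemma dg_add: "dg f + dg g = dg (\<lambda>l. f l + g l)"
  unfolding dg_def of_coords_add by (intro arg_cong [where f = of_coords]) (simp add: mat_eq_iff)

lemma dg_diff: "dg f - dg g = dg (\<lambda>l. f l - g l)"
  using dg_add [of "\<lambda>l. f l - g l" g] by (simp add: eq_diff_eq [symmetric])

lemma dg_scale: "map_matrix ((*) a) (dg f) = dg (\<lambda>l. a * f l)"
  unfolding dg_def of_coords_scale by (intro arg_cong [where f = of_coords]) (simp add: mat_eq_iff)

lemma dg_sum: "(\<Sum>k\<in>K. dg (f k)) = dg (\<lambda>l. \<Sum>k\<in>K. f k l)"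
  unfolding dg_def of_coords_sum by (intro arg_cong [where f = of_coords]) (simp add: mat_eq_iff)

lemma dg_eq_iff: "dg f = dg g \<longleftrightarrow> f = g"
proof
  assume "dg f = dg g"
  then have "(\<chi> r s. if r = s then f r else 0) = (\<chi> r s. if r = s then g r else (0 :: complex))"
    unfolding dg_def of_coords_eq_iff .
  then have "(\<chi> r s. if r = s then f r else 0) $ l $ l
      = (\<chi> r s. if r = s then g r else (0 :: complex)) $ l $ l" for l
    by simp
  then show "f = g"
    by (simp add: fun_eq_iff)
qed simp

lemma dg_zero: "dg (\<lambda>l. 0) = 0"
proof -
  have "(\<chi> r s. if r = s then 0 else 0) = (0 :: complex^'n^'n)"
    by (simp add: mat_eq_iff)
  then show ?thesis
    by (simp add: dg_def of_coords_zero)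
qed

lemma dg_eq_0_iff: "dg f = 0 \<longleftrightarrow> (\<forall>l. f l = 0)"
  using dg_eq_iff [of f "\<lambda>l. 0"] by (simp add: dg_zero fun_eq_iff)

lemma unit_scale: "map_matrix ((*) a) (unit i j b) = unit i j (a * b)"
  unfolding unit_def of_coords_scale by (intro arg_cong [where f = of_coords]) (simp add: mat_eq_iff)

lemma mat_1_eq_dg: "mat 1 = dg (\<lambda>i. 1)"
proof -
  have "(\<chi> r s. if r = s then 1 else 0) = (mat 1 :: complex^'n^'n)"
    by (simp add: mat_def)
  then show ?thesis
    by (simp add: dg_def of_coords_def ST)
qed

lemma Q_eq_dg: "Q = dg q"
  by (simp add: dg_def of_coords_def diagonal)

lemma P_eq_dg: "P = dg (\<lambda>i. 1 / q i)"
proof -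
  have "P = P ** (Q ** dg (\<lambda>i. 1 / q i))"
    by (simp add: Q_eq_dg dg_mult q_nonzero flip: mat_1_eq_dg)
  also have "\<dots> = dg (\<lambda>i. 1 / q i)"
    by (simp add: matrix_mul_assoc inverse)
  finally show ?thesis .
qed

lemma unit_commute_Q: "q i = q j \<Longrightarrow> unit i j a ** Q = Q ** unit i j a"
  by (simp add: Q_eq_dg dg_unit unit_dg mult.commute)

text \<open>Inside a block of equal eigenvalues the matrix units commute with \<open>Q\<close>, and their commutators
  give all matrix units off the diagonal as well as the differences on the diagonal.\<close>

lemma realisable_unit:
  assumes "i \<noteq> j" "q i = q j"
  shows "realisable (unit i j a)"
  using realisable_commutator [OF unit_commute_Q unit_commute_Q, of i j i i a 1] assms
  by (simp add: unit_mult)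

lemma realisable_unit_diff:
  assumes "q i = q j"
  shows "realisable (unit i i a - unit j j a)"
proof (cases "i = j")
  case False
  then show ?thesis
    using realisable_commutator [OF unit_commute_Q unit_commute_Q, of j i i j 1 a] assms
    by (simp add: unit_mult)
qed (simp add: realisable_zero)

lemma realisable_unit_pair:
  assumes "q i = q j" "a + b = 0"
  shows "realisable (unit i i a + unit j j b)"
proof -
  have "unit j j b = - unit j j a"
    using assms(2) by (simp add: unit_minus add_eq_0_iff)
  then show ?thesis
    using realisable_unit_diff [OF assms(1), of a] by simp
qed

text \<open>
  The diagonal of the representation consists of the characters \<open>\<epsilon>, g, h, \<epsilon>\<close>, where a diagonal
  matrix in the eigenbasis stands for the character that sends \<open>u\<^sup>t\<close> to it. A matrix unit
  \<open>e\<^sub>r\<^sub>s\<close> can be placed between neighbouring characters \<open>\<alpha>\<close> and \<open>\<beta>\<close> iff \<open>\<alpha> q / \<beta>\<close>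
  takes the same value at \<open>r\<close> and at \<open>s\<close>. For \<open>e\<^sub>i\<^sub>j\<close>, \<open>e\<^sub>j\<^sub>k\<close>, \<open>e\<^sub>k\<^sub>i\<close> between
  the four characters this asks for \<open>q i / g i = q j / g j\<close>,
  \<open>g j q j / h j = g k q k / h k\<close> and \<open>h k q k = h i q i\<close>; the values of \<open>g\<close> and \<open>h\<close>
  below make all six quotients and products equal to \<open>1\<close>. The products of consecutive units are
  multiples of \<open>e\<^sub>i\<^sub>k\<close> and \<open>e\<^sub>j\<^sub>i\<close>, at places where these two units are not admissible. For that
  reason the relations there can be solved, by \<open>c e\<^sub>i\<^sub>k\<close> and \<open>d e\<^sub>j\<^sub>i\<close>. What is left is the
  corner, a combination of \<open>e\<^sub>i\<^sub>i\<close>, \<open>e\<^sub>j\<^sub>j\<close> and \<open>e\<^sub>k\<^sub>k\<close>.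
\<close>

lemma realisable_distinct:
  assumes ij: "q i \<noteq> q j" and ik: "q i \<noteq> q k" and jk: "q j \<noteq> q k"
  defines "c \<equiv> (q k)\<^sup>2 / (q j * ((q k)\<^sup>2 - (q i)\<^sup>2))"
    and "d \<equiv> q k * (q i)\<^sup>2 / ((q i)\<^sup>2 - (q j)\<^sup>2)"
  shows "realisable (unit i i (- (d / (q i * q j) + c * q i / q k) * q i)
           + unit j j (d / q i) + unit k k (c * q i))"
proof -
  have neq: "i \<noteq> j" "i \<noteq> k" "j \<noteq> k" "j \<noteq> i" "k \<noteq> i" "k \<noteq> j"
    using assms by auto
  have sq: "(q i)\<^sup>2 - (q j)\<^sup>2 \<noteq> 0" "(q k)\<^sup>2 - (q i)\<^sup>2 \<noteq> 0"
    using ij ik q_square by fastforce+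
  have sq': "q i * q i \<noteq> q j * q j" "q k * q k \<noteq> q i * q i"
    using sq by (simp_all add: power2_eq_square)
  have eqs: "- (q i * c * q i) - q j * (q k)\<^sup>2 / (q j)\<^sup>2 + c * q k * q k = 0"
    "- (q j * d / q i) - c * q k * q i = (- (d / (q i * q j)) - c * q i / q k) * q i * q i"
    "- (q j * q j * d / q i) - q k * q i + d * q i = 0"
    "c / q i - 1 / (q i * q j) = c * q i / (q k * q k)"
    "d / (q j * q j) - q k / (q j * q j) = d / (q i * q i)"
    using sq' q_nonzero by (simp_all add: c_def d_def power2_eq_square divide_simps)
      (simp_all add: algebra_simps)
  define g where "g = (\<lambda>l. if l = i \<or> l = j then q l else if l = k then 1 / (q k)\<^sup>2 else 1)"
  define h where "h = (\<lambda>l. if l = i \<or> l = k then 1 / q l else if l = j then (q j)\<^sup>2 else 1)"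
  have g: "g i = q i" "g j = q j" "g k = 1 / (q k)\<^sup>2" "g l \<noteq> 0" for l
    using neq by (simp_all add: g_def q_nonzero)
  have h: "h i = 1 / q i" "h j = (q j)\<^sup>2" "h k = 1 / q k" "h l \<noteq> 0" for l
    using neq by (simp_all add: h_def q_nonzero)
  let ?x = "\<lambda>a b. if a = b then (if a = 1 then dg g else if a = 2 then dg h else dg (\<lambda>l. 1))
      else if a = 0 \<and> b = 1 then unit i j 1
      else if a = 1 \<and> b = 2 then unit j k 1
      else if a = 2 \<and> b = 3 then unit k i 1
      else if a = 0 \<and> b = 2 then unit i k c
      else if a = 1 \<and> b = (3::nat) then unit j i d else 0"
  \<comment> \<open>The blocks of \<open>v\<close> are forced: they are the transposed blocks of the inverse of \<open>u\<close>.\<close>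
  let ?y = "\<lambda>a b. if a = b then (if a = 1 then dg (\<lambda>l. 1 / g l)
        else if a = 2 then dg (\<lambda>l. 1 / h l) else dg (\<lambda>l. 1))
      else if a = 0 \<and> b = 1 then unit i j (- 1 / g i)
      else if a = 1 \<and> b = 2 then unit j k (- 1 / (h j * g k))
      else if a = 2 \<and> b = 3 then unit k i (- 1 / h i)
      else if a = 0 \<and> b = 2 then unit i k (- c / h i)
      else if a = 1 \<and> b = (3::nat) then unit j i (- d / g i)
      else if a = 0 \<and> b = 3 then unit j j (d / g i) + unit k k (c / h i) else 0"
  show ?thesis
  proof (rule realisable_triangular [of ?x ?y])
    fix a b :: nat
    assume "a < 4" "b < 4"
    then have "a = 0 \<or> a = 1 \<or> a = 2 \<or> a = 3" "b = 0 \<or> b = 1 \<or> b = 2 \<or> b = 3"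
      by (simp_all add: less_4_iff)
    then show "(\<Sum>m<4. ?y m b ** ?x a m) = (if a = b then mat 1 else 0)"
      "(\<Sum>m<4. ?x m b ** ?y a m) = (if a = b then mat 1 else 0)"
      "(\<Sum>m<4. ?x a m ** Q ** ?y m b) = (if a = b then Q else 0)
         + (if a = 0 \<and> b = 3 then (unit i i (- (d / (q i * q j) + c * q i / q k) * q i)
           + unit j j (d / q i) + unit k k (c * q i)) ** Q else 0)"
      "(\<Sum>m<4. ?y a m ** P ** ?x m b) = (if a = b then P else 0)
         + (if a = 0 \<and> b = 3 then P ** (unit i i (- (d / (q i * q j) + c * q i / q k) * q i)
           + unit j j (d / q i) + unit k k (c * q i)) else 0)"
      unfolding sum_lessThan_4
      by (elim disjE; simp add: mat_1_eq_dg Q_eq_dg P_eq_dg neq dg_mult dg_unit unit_dg unit_mult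
          matrix_add_ldistrib matrix_add_rdistrib q_nonzero;
          simp add: g h unit_add unit_eq_0_iff unit_diagonal dg_add dg_eq_iff dg_eq_0_iff fun_eq_iff
            q_nonzero neq eqs; simp add: power2_eq_square q_nonzero eqs)+
  qed (auto simp: mat_1_eq_dg)
qed

text \<open>Up to a common factor, the coefficients are the cross product of the vectors
  \<open>(q i, q j, q k)\<close> and \<open>(1 / q i, 1 / q j, 1 / q k)\<close>, the only solution of the two trace conditions
  that is supported on three places with distinct eigenvalues. In this form the case of coinciding
  eigenvalues is included, where it reduces to a difference of two matrix units.\<close>

lemma realisable_triple:
  "realisable (unit i i (q i * ((q j)\<^sup>2 - (q k)\<^sup>2)) + unit j j (q j * ((q k)\<^sup>2 - (q i)\<^sup>2))
     + unit k k (q k * ((q i)\<^sup>2 - (q j)\<^sup>2)))"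
    (is "realisable ?B")
proof -
  consider "q i = q j" | "q i = q k" | "q j = q k" | "q i \<noteq> q j" "q i \<noteq> q k" "q j \<noteq> q k"
    by blast
  then show ?thesis
  proof cases
    case 1
    then have "unit k k (q k * ((q i)\<^sup>2 - (q j)\<^sup>2)) = 0"
      by (simp add: unit_eq_0_iff)
    then show ?thesis
      using 1 by (simp add: realisable_unit_pair algebra_simps)
  next
    case 2
    then have "unit j j (q j * ((q k)\<^sup>2 - (q i)\<^sup>2)) = 0"
      by (simp add: unit_eq_0_iff)
    then show ?thesis
      using 2 by (simp add: realisable_unit_pair algebra_simps)
  next
    case 3
    then have "unit i i (q i * ((q j)\<^sup>2 - (q k)\<^sup>2)) = 0"
      by (simp add: unit_eq_0_iff)
    then show ?thesis
      using 3 by (simp add: realisable_unit_pair algebra_simps)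
  next
    case 4
    let ?c = "(q k)\<^sup>2 / (q j * ((q k)\<^sup>2 - (q i)\<^sup>2))"
    let ?d = "q k * (q i)\<^sup>2 / ((q i)\<^sup>2 - (q j)\<^sup>2)"
    let ?a = "q j * ((q k)\<^sup>2 - (q i)\<^sup>2) * ((q i)\<^sup>2 - (q j)\<^sup>2) / (q i * q k)"
    have sq: "q i * q i \<noteq> q j * q j" "q k * q k \<noteq> q i * q i"
      using 4 q_square [of i j] q_square [of k i] by (auto simp: power2_eq_square)
    have "?a * (- (?d / (q i * q j) + ?c * q i / q k) * q i) = q i * ((q j)\<^sup>2 - (q k)\<^sup>2)"
      "?a * (?d / q i) = q j * ((q k)\<^sup>2 - (q i)\<^sup>2)" "?a * (?c * q i) = q k * ((q i)\<^sup>2 - (q j)\<^sup>2)"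
      using sq q_nonzero by (simp_all add: power2_eq_square divide_simps) (simp_all add: algebra_simps)
    then show ?thesis
      using realisable_scale [OF realisable_distinct [OF 4], of ?a]
      by (simp only: map_matrix_times_add unit_scale)
  qed
qed

text \<open>Fix two places \<open>i\<close>, \<open>j\<close> with distinct eigenvalues. The triples \<open>(i, j, k)\<close> with weights
  \<open>a k / q k\<close> add up to \<open>(q i\<^sup>2 - q j\<^sup>2) a\<close>, because the coefficients that accumulate at
  \<open>i\<close> and \<open>j\<close> are combinations of the two trace conditions.\<close>

lemma realisable_dg:
  assumes tr: "(\<Sum>i\<in>UNIV. a i * q i) = 0" "(\<Sum>i\<in>UNIV. a i / q i) = 0"
  shows "realisable (dg a)"
proof (cases "\<exists>i j. q i \<noteq> q j")
  case True
  then obtain i j where ij: "q i \<noteq> q j"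
    by blast
  let ?D = "(q i)\<^sup>2 - (q j)\<^sup>2"
  have D: "?D \<noteq> 0"
    using ij q_square by auto
  let ?t = "\<lambda>k. unit i i (q i * ((q j)\<^sup>2 - (q k)\<^sup>2)) + unit j j (q j * ((q k)\<^sup>2 - (q i)\<^sup>2))
     + unit k k (q k * ?D)"
  let ?s = "\<lambda>k. a k / q k / ?D"
  have "(\<Sum>k\<in>UNIV. ?s k * (q i * ((q j)\<^sup>2 - (q k)\<^sup>2)))
      = (\<Sum>k\<in>UNIV. q i / ?D * (q j)\<^sup>2 * (a k / q k) - q i / ?D * (a k * q k))"
    using D by (intro sum.cong) (simp_all add: q_nonzero divide_simps power2_eq_square, simp_all add: algebra_simps)
  also have "\<dots> = 0"
    unfolding sum_subtractf sum_distrib_left [symmetric] tr by simp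
  finally have si: "(\<Sum>k\<in>UNIV. ?s k * (q i * ((q j)\<^sup>2 - (q k)\<^sup>2))) = 0" .
  have "(\<Sum>k\<in>UNIV. ?s k * (q j * ((q k)\<^sup>2 - (q i)\<^sup>2)))
      = (\<Sum>k\<in>UNIV. q j / ?D * (a k * q k) - q j / ?D * (q i)\<^sup>2 * (a k / q k))"
    using D by (intro sum.cong) (simp_all add: q_nonzero divide_simps power2_eq_square, simp_all add: algebra_simps)
  also have "\<dots> = 0"
    unfolding sum_subtractf sum_distrib_left [symmetric] tr by simp
  finally have sj: "(\<Sum>k\<in>UNIV. ?s k * (q j * ((q k)\<^sup>2 - (q i)\<^sup>2))) = 0" .
  have "(\<Sum>k\<in>UNIV. ?s k * ((if l = i then q i * ((q j)\<^sup>2 - (q k)\<^sup>2) else 0)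
        + (if l = j then q j * ((q k)\<^sup>2 - (q i)\<^sup>2) else 0) + (if l = k then q k * ?D else 0)))
      = (if l = i then \<Sum>k\<in>UNIV. ?s k * (q i * ((q j)\<^sup>2 - (q k)\<^sup>2)) else 0)
        + (if l = j then \<Sum>k\<in>UNIV. ?s k * (q j * ((q k)\<^sup>2 - (q i)\<^sup>2)) else 0)
        + (\<Sum>k\<in>UNIV. if k = l then ?s k * (q k * ?D) else 0)" for l
    unfolding distrib_left sum.distrib by (intro arg_cong2 [where f = "(+)"] sum.cong) auto
  also have "\<dots> l = a l" for l
    unfolding si sj using D q_nonzero by simp
  finally have "dg a = (\<Sum>k\<in>UNIV. map_matrix ((*) (?s k)) (?t k))"
    by (simp only: unit_diagonal dg_add dg_scale dg_sum dg_eq_iff fun_eq_iff) simp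
  then show ?thesis
    by (simp only: realisable_sum realisable_scale realisable_triple)
next
  case False
  define i :: 'n where "i = undefined"
  have q: "q k = q i" for k
    using False by blast
  have "(\<Sum>k\<in>UNIV. a k) * q i = 0"
    using tr(1) q by (metis (mono_tags, lifting) sum.cong sum_distrib_right)
  then have sum: "(\<Sum>k\<in>UNIV. a k) = 0"
    by (simp add: q_nonzero)
  have "(\<Sum>k\<in>UNIV. (if l = k then a k else 0) - (if l = i then a k else 0)) = a l" for l
    using sum by (cases "l = i") (simp_all add: sum_subtractf)
  then have "dg a = (\<Sum>k\<in>UNIV. unit k k (a k) - unit i i (a k))"
    by (simp add: unit_diagonal dg_diff dg_sum dg_eq_iff fun_eq_iff)
  then show ?thesis
    by (simp only: realisable_sum realisable_unit_diff [OF q])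
qed

lemma coords_mult_Q: "coords (A ** Q) $ i $ j = coords A $ i $ j * q j"
proof -
  have "coords (A ** Q) = coords A ** (\<chi> i j. if i = j then q i else 0)"
    by (simp add: coords_def diagonal ST_left ST flip: matrix_mul_assoc)
  then show ?thesis
    by (simp add: matrix_matrix_mult_nth if_distrib [of "\<lambda>x. _ * x"] cong: if_cong)
qed

lemma coords_Q_mult: "coords (Q ** A) $ i $ j = q i * coords A $ i $ j"
proof -
  have "coords (Q ** A) = (\<chi> i j. if i = j then q i else 0) ** coords A"
    by (simp add: coords_def diagonal ST_left ST flip: matrix_mul_assoc)
  then show ?thesis
    by (simp add: matrix_matrix_mult_nth if_distrib [of "\<lambda>x. x * _"] cong: if_cong)
qed

lemma trace_coords: "trace (coords A) = trace A"
  using trace_mul_sym [of "T ** A" S]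
  by (simp add: coords_def matrix_mul_assoc ST)

lemma coords_eq_iff: "coords A = coords B \<longleftrightarrow> A = B"
  by (metis of_coords_coords)

lemma coords_eqI: "(\<And>i j. coords A $ i $ j = coords B $ i $ j) \<Longrightarrow> A = B"
  using coords_eq_iff [of A B] by (simp add: mat_eq_iff [of "coords A"])

lemma coords_add: "coords (A + B) = coords A + coords B"
  by (simp add: coords_def matrix_add_ldistrib matrix_add_rdistrib)

lemma coords_sum: "coords (\<Sum>k\<in>K. h k) = (\<Sum>k\<in>K. coords (h k))"
  unfolding coords_def sum_matrix_mult_right sum_matrix_mult_left ..

lemma coords_mult_P: "coords (A ** P) $ i $ j = coords A $ i $ j / q j"
proof -
  have "coords (A ** P) $ i $ j * q j = coords A $ i $ j"
    by (simp add: inverse flip: coords_mult_Q matrix_mul_assoc)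
  then show ?thesis
    using q_nonzero [of j] by (simp add: field_simps)
qed

lemma commute_Q_iff: "A ** Q = Q ** A \<longleftrightarrow> (\<forall>i j. q i \<noteq> q j \<longrightarrow> coords A $ i $ j = 0)"
proof -
  have "A ** Q = Q ** A \<longleftrightarrow> coords (A ** Q) = coords (Q ** A)"
    by (simp only: coords_eq_iff)
  also have "\<dots> \<longleftrightarrow> (\<forall>i j. q i \<noteq> q j \<longrightarrow> coords A $ i $ j = 0)"
    by (simp add: mat_eq_iff coords_mult_Q coords_Q_mult) metis
  finally show ?thesis .
qed

theorem realisable_traceless:
  assumes A: "A ** Q = Q ** A" and tr: "trace (A ** Q) = 0" "trace (A ** P) = 0"
  shows "realisable A"
proof -
  let ?a = "\<lambda>i j. coords A $ i $ j"
  have "A = dg (\<lambda>i. ?a i i) + (\<Sum>i\<in>UNIV. \<Sum>j\<in>UNIV. if i = j then 0 else unit i j (?a i j))"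
  proof -
    have u: "coords (if i = j then 0 else unit i j (?a i j)) $ r $ s
        = (if s = j then if r = i then (if i = j then 0 else ?a i j) else 0 else 0)" for i j r s
      by (simp add: unit_def) (simp add: coords_def)
    have "coords A = coords (dg (\<lambda>i. ?a i i))
        + (\<Sum>i\<in>UNIV. \<Sum>j\<in>UNIV. coords (if i = j then 0 else unit i j (?a i j)))"
      by (subst mat_eq_iff) (simp add: u, simp add: dg_def)
    also have "\<dots> = coords (dg (\<lambda>i. ?a i i)
        + (\<Sum>i\<in>UNIV. \<Sum>j\<in>UNIV. if i = j then 0 else unit i j (?a i j)))"
      by (simp only: coords_add coords_sum)
    finally show ?thesis
      by (simp only: coords_eq_iff)
  qed
  moreover have "realisable (dg (\<lambda>i. ?a i i))"
  proof (rule realisable_dg)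
    show "(\<Sum>i\<in>UNIV. ?a i i * q i) = 0" "(\<Sum>i\<in>UNIV. ?a i i / q i) = 0"
      using tr unfolding trace_coords [of "A ** Q", symmetric] trace_coords [of "A ** P", symmetric]
      by (simp_all add: trace_def coords_mult_Q coords_mult_P)
  qed
  moreover have "realisable (if i = j then 0 else unit i j (?a i j))" for i j
  proof (cases "i \<noteq> j \<and> q i = q j")
    case True
    then show ?thesis
      by (simp add: realisable_unit)
  next
    case False
    then have "(if i = j then 0 else unit i j (?a i j)) = 0"
      using A by (auto simp: commute_Q_iff unit_eq_0_iff)
    then show ?thesis
      by (simp add: realisable_zero)
  qed
  ultimately show ?thesis
    by (metis (no_types, lifting) realisable_add realisable_sum)
qed

subsection \<open>Projection onto the commutant\<close>

text \<open>The projection along the image of \<open>X \<mapsto> X - Q X P\<close>, which multiplies the coordinate at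
  \<open>(i, j)\<close> by \<open>1 - q i / q j\<close>.\<close>

definition commutant_part :: "complex^'n^'n \<Rightarrow> complex^'n^'n" where
  "commutant_part M = of_coords (\<chi> i j. if q i = q j then coords M $ i $ j else 0)"

lemma coords_commutant_part:
  "coords (commutant_part M) $ i $ j = (if q i = q j then coords M $ i $ j else 0)"
  by (simp add: commutant_part_def)

lemma coords_nth_simps:
  "coords (A + B) $ i $ j = coords A $ i $ j + coords B $ i $ j"
  "coords (A - B) $ i $ j = coords A $ i $ j - coords B $ i $ j"
  "coords (map_matrix ((*) a) A) $ i $ j = a * coords A $ i $ j"
  by (simp_all add: coords_def matrix_add_ldistrib matrix_add_rdistrib matrix_diff_ldistrib
      matrix_diff_rdistrib matrix_matrix_mult_nth sum_distrib_left sum_distrib_right ac_simps)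

lemma commutant_part_add: "commutant_part (A + B) = commutant_part A + commutant_part B"
  by (rule coords_eqI) (simp add: coords_commutant_part coords_nth_simps)

lemma commutant_part_scale:
  "commutant_part (map_matrix ((*) a) A) = map_matrix ((*) a) (commutant_part A)"
  by (rule coords_eqI) (simp add: coords_commutant_part coords_nth_simps)

lemma commutant_part_commutes: "commutant_part A ** Q = Q ** commutant_part A"
  by (simp add: commute_Q_iff coords_commutant_part)

lemma commutant_part_id: "A ** Q = Q ** A \<Longrightarrow> commutant_part A = A"
  unfolding commute_Q_iff by (rule coords_eqI) (simp add: coords_commutant_part)

lemma coords_conj: "coords (X - Q ** X ** P) $ i $ j = coords X $ i $ j * (1 - q i / q j)"
  by (simp add: coords_nth_simps coords_mult_P coords_Q_mult algebra_simps)

lemma commutant_part_conj: "commutant_part (X - Q ** X ** P) = 0"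
  by (rule coords_eqI) (simp add: coords_commutant_part coords_conj q_nonzero, simp add: coords_def)

lemma commutant_part_eq_0:
  assumes "commutant_part M = 0"
  shows "\<exists>X. M = X - Q ** X ** P"
proof -
  let ?X = "of_coords (\<chi> i j. if q i = q j then 0 else coords M $ i $ j / (1 - q i / q j))"
  have "coords (commutant_part M) = 0"
    using assms by (simp add: coords_def)
  then have "coords M $ i $ j = 0" if "q i = q j" for i j
    using that coords_commutant_part [of M i j] by simp
  then have "M = ?X - Q ** ?X ** P"
    by (intro coords_eqI) (auto simp: coords_conj q_nonzero)
  then show ?thesis
    by blast
qed

lemma trace_commutant_part:
  "trace (commutant_part M ** Q) = trace (M ** Q)" "trace (commutant_part M ** P) = trace (M ** P)"
  unfolding trace_coords [of "commutant_part M ** Q", symmetric] trace_coords [of "M ** Q", symmetric]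
    trace_coords [of "commutant_part M ** P", symmetric] trace_coords [of "M ** P", symmetric]
  by (simp_all add: trace_def coords_mult_Q coords_mult_P coords_commutant_part)

end


section \<open>Diagonalising a strictly positive matrix\<close>

text \<open>Suppose that the orthogonal complement \<open>W\<close> of all eigenvectors is not zero. It is invariant, and
  the quadratic form of \<open>f\<close> attains its maximum \<open>l\<close> on the unit sphere of \<open>W\<close> at some \<open>x0\<close>.
  The form of \<open>l - f\<close> is then nonnegative on \<open>W\<close> and zero at \<open>x0\<close>. Evaluating it along the
  line through \<open>x0\<close> in the direction \<open>z = l x0 - f x0\<close> shows \<open>z = 0\<close>, so \<open>x0\<close> is an eigenvector
  orthogonal to itself.\<close>

lemma selfadjoint_eigenvectors_span:
  fixes f :: "'a::euclidean_space \<Rightarrow> 'a"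
  assumes lin: "linear f" and adj: "\<And>x y. inner (f x) y = inner x (f y)"
  shows "span {v. \<exists>c. f v = c *\<^sub>R v} = UNIV"
proof -
  let ?E = "{v. \<exists>c. f v = c *\<^sub>R v}"
  let ?W = "{x. \<forall>v\<in>?E. inner v x = 0}"
  note f = linear_add [OF lin] linear_scale [OF lin] linear_diff [OF lin]
  have f_W: "f x \<in> ?W" if "x \<in> ?W" for x
  proof -
    have "inner v (f x) = 0" if "v \<in> ?E" for v
      using that \<open>x \<in> ?W\<close> adj [of v x] by auto
    then show ?thesis
      by blast
  qed
  have W0: "x = 0" if x: "x \<in> ?W" for x
  proof (rule ccontr)
    assume "x \<noteq> 0"
    let ?K = "?W \<inter> sphere 0 1"
    have "?W = (\<Inter>v\<in>?E. {x. inner v x = 0})"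
      by auto
    then have "closed ?W"
      by (auto intro!: closed_INT closed_hyperplane)
    then have "compact ?K"
      by (simp add: closed_Int_compact)
    moreover have "x /\<^sub>R norm x \<in> ?K"
      using x \<open>x \<noteq> 0\<close> by auto
    moreover have "continuous_on ?K (\<lambda>x. inner x (f x))"
      by (intro continuous_intros linear_continuous_on linear_conv_bounded_linear [THEN iffD1] lin)
    ultimately obtain x0 where x0: "x0 \<in> ?K" and max: "\<And>y. y \<in> ?K \<Longrightarrow> inner y (f y) \<le> inner x0 (f x0)"
      using continuous_attains_sup [of ?K "\<lambda>x. inner x (f x)"] by blast
    define l where "l = inner x0 (f x0)"
    define z where "z = l *\<^sub>R x0 - f x0"
    have unit: "inner x0 x0 = 1"
      using x0 by (simp add: dot_square_norm)
    have form: "inner y (f y) \<le> l * inner y y" if y: "y \<in> ?W" for y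
    proof (cases "y = 0")
      case False
      then have "y /\<^sub>R norm y \<in> ?K"
        using y by auto
      from max [OF this] have "inner y (f y) / (norm y)\<^sup>2 \<le> l"
        by (simp add: f l_def power2_eq_square field_simps)
      then show ?thesis
        using False by (simp add: divide_le_eq dot_square_norm)
    qed (simp add: linear_0 [OF lin])
    have z: "z \<in> ?W"
      using x0 f_W [of x0] by (auto simp: z_def inner_diff_right)
    define k where "k = l * inner z z - inner z (f z)"
    have k: "k \<ge> 0"
      using form [OF z] by (simp add: k_def)
    have quadratic: "0 \<le> 2 * t * inner z z + t\<^sup>2 * k" for t
    proof -
      have xz: "inner x0 (f z) = inner z (f x0)"
        using adj [of x0 z] by (simp add: inner_commute)
      have zz: "inner z z = l * inner z x0 - inner z (f x0)"
        by (subst (2) z_def) (simp add: inner_diff_right)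
      have "x0 + t *\<^sub>R z \<in> ?W"
        using x0 z by (auto simp: inner_add_right)
      from form [OF this]
      have "0 \<le> l * inner (x0 + t *\<^sub>R z) (x0 + t *\<^sub>R z) - inner (x0 + t *\<^sub>R z) (f (x0 + t *\<^sub>R z))"
        by simp
      also have "\<dots> = l * inner x0 x0 - inner x0 (f x0) + 2 * t * (l * inner z x0 - inner z (f x0)) + t\<^sup>2 * k"
        unfolding k_def f inner_add_left inner_add_right inner_scaleR_left inner_scaleR_right xz
          inner_commute [of x0 z]
        by (simp add: algebra_simps power2_eq_square)
      also have "\<dots> = 2 * t * inner z z + t\<^sup>2 * k"
        by (simp add: unit zz flip: l_def)
      finally show ?thesis .
    qed
    have "inner z z = 0"
    proof (rule ccontr)
      assume "inner z z \<noteq> 0"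
      then have s: "inner z z > 0"
        by simp
      \<comment> \<open>For small negative \<open>t\<close> the linear term dominates; this \<open>t\<close> is small enough.\<close>
      define t where "t = - (inner z z / (k + 1))"
      have "t < 0"
        using s k by (simp add: t_def)
      have "t * k = - inner z z * (k / (k + 1))"
        by (simp add: t_def)
      moreover have "inner z z * (k / (k + 1)) \<le> inner z z"
        using s k by (intro mult_left_le) simp_all
      ultimately have "2 * inner z z + t * k > 0"
        using s by linarith
      then have "t * (2 * inner z z + t * k) < 0"
        using \<open>t < 0\<close> by (simp add: mult_neg_pos)
      then show False
        using quadratic [of t] by (simp add: algebra_simps power2_eq_square)
    qed
    then have "f x0 = l *\<^sub>R x0"
      by (simp add: z_def)
    then have "inner x0 x0 = 0"
      using x0 by blast
    then show False
      using unit by simp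
  qed
  have "x \<in> span ?E" for x
  proof -
    obtain y z where "y \<in> span ?E" "\<And>w. w \<in> span ?E \<Longrightarrow> orthogonal z w" "x = y + z"
      using orthogonal_subspace_decomp_exists [of ?E x] by blast
    moreover from this have "z \<in> ?W"
      by (auto simp: orthogonal_def inner_commute span_base)
    ultimately show ?thesis
      using W0 [of z] by simp
  qed
  then show ?thesis
    by blast
qed

text \<open>The real inner product of complex vectors is the real part of the Hermitian one, so a Hermitian
  matrix is selfadjoint for it, and real spans of eigenvectors lie in complex ones.\<close>

lemma inner_complex_vec: "inner x y = Re (\<Sum>i\<in>UNIV. cnj (x $ i) * (y :: complex^'n) $ i)"
  by (simp add: inner_vec_def inner_complex_def)

lemma strictly_positive_diagonalisable:
  fixes Q :: "complex^'n::finite^'n"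
  assumes pos: "strictly_positive Q"
  obtains S T :: "complex^'n^'n" and r :: "'n \<Rightarrow> real" where
    "S ** T = mat 1" "T ** S = mat 1"
    "Q = S ** (\<chi> i j. if i = j then of_real (r i) else 0) ** T" "\<And>i. r i > 0"
proof -
  have herm: "cnj (Q $ i $ j) = Q $ j $ i" for i j
    using pos unfolding strictly_positive_def mat_eq_iff by (simp add: transpose_def)
  have adj: "inner (Q *v x) y = inner x (Q *v y)" for x y
  proof -
    have "(\<Sum>i\<in>UNIV. cnj ((Q *v x) $ i) * y $ i)
        = (\<Sum>i\<in>UNIV. \<Sum>j\<in>UNIV. cnj (x $ j) * (Q $ j $ i * y $ i))"
      by (simp add: matrix_vector_mult_def sum_distrib_left sum_distrib_right herm ac_simps)
    also have "\<dots> = (\<Sum>j\<in>UNIV. cnj (x $ j) * (Q *v y) $ j)"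
      by (subst sum.swap) (simp add: matrix_vector_mult_def sum_distrib_left)
    finally show ?thesis
      by (simp add: inner_complex_vec)
  qed
  have scaleR: "c *\<^sub>R v = of_real c *s v" for c and v :: "complex^'n"
    by (simp add: vec_eq_iff) (simp add: scaleR_conv_of_real)
  have lin: "linear ((*v) Q)"
    by (rule linearI) (simp_all add: scaleR matrix_vector_right_distrib vector_scalar_commute)
  define E where "E = {v. \<exists>c. Q *v v = c *\<^sub>R v}"
  have "span E = UNIV"
    unfolding E_def by (rule selfadjoint_eigenvectors_span [OF lin adj])
  have "v \<in> vec.span E" if "v \<in> span E" for v
    using that
  proof (induction rule: span_induct_alt)
    case base
    show ?case
      by (rule vec.span_zero)
  next
    case (step c x y)
    then show ?case
      unfolding scaleR by (intro vec.span_add vec.span_scale) (auto intro: vec.span_base)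
  qed
  then have spanE: "vec.span E = UNIV"
    using \<open>span E = UNIV\<close> by blast
  obtain B where B: "B \<subseteq> E" "vec.independent B" "E \<subseteq> vec.span B"
    by (rule vec.maximal_independent_subset)
  have spanB: "vec.span B = UNIV"
    using vec.span_mono [OF B(3)] spanE by (auto simp: vec.span_span)
  have "card B = CARD('n)"
    using vec.basis_card_eq_dim [of B UNIV] B(2) spanB vec_dim_card by auto
  moreover have "finite B"
    using B(2) vec.independent_explicit by blast
  ultimately obtain b where b: "bij_betw b (UNIV :: 'n set) B"
    using finite_same_card_bij [of "UNIV :: 'n set" B] by auto
  have "\<exists>c. Q *v b j = c *\<^sub>R b j" for j
    using b B(1) by (auto simp: bij_betw_def E_def)
  then obtain r where r: "Q *v b j = r j *\<^sub>R b j" for j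
    by metis
  define S where "S = (\<chi> i j. b j $ i)"
  have "columns S = range b"
    by (auto simp: columns_def column_def S_def vec_lambda_eta)
  then have "vec.span (columns S) = UNIV"
    using b spanB by (simp add: bij_betw_def)
  then obtain T where ST: "S ** T = mat 1"
    using matrix_right_invertible_span_columns [of S] by blast
  then have TS: "T ** S = mat 1"
    using matrix_left_right_inverse by blast
  have "(Q ** S) $ i $ j = (Q *v b j) $ i" for i j
    by (simp add: matrix_matrix_mult_nth matrix_vector_mult_def S_def)
  then have "Q ** S = S ** (\<chi> i j. if i = j then of_real (r i) else 0)"
    by (simp add: mat_eq_iff r matrix_matrix_mult_nth S_def scaleR
        if_distrib [of "\<lambda>x. _ * x"] cong: if_cong)
  then have Q: "Q = S ** (\<chi> i j. if i = j then of_real (r i) else 0) ** T"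
    by (metis ST matrix_mul_assoc matrix_mul_rid)
  have "r j > 0" for j
  proof -
    have "b j \<in> B"
      using b by (auto simp: bij_betw_def)
    then have "b j \<noteq> 0"
      using B(2) vec.dependent_zero by metis
    then have "0 < Re (\<Sum>i\<in>UNIV. cnj (b j $ i) * (Q *v b j) $ i)"
      using pos by (simp add: strictly_positive_def)
    also have "\<dots> = inner (b j) (Q *v b j)"
      by (simp only: inner_complex_vec)
    also have "\<dots> = r j * (norm (b j))\<^sup>2"
      by (simp add: r dot_square_norm)
    finally show ?thesis
      using \<open>b j \<noteq> 0\<close> by (simp add: zero_less_mult_iff)
  qed
  then show thesis
    using that ST TS Q by blast
qed

lemma strictly_positive_eigenbasis:
  fixes Q :: "complex^'n::finite^'n"
  assumes "strictly_positive Q"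
  shows "\<exists>P S T q. eigenbasis Q P S T q"
proof -
  obtain S T :: "complex^'n^'n" and r where ST: "S ** T = mat 1" "T ** S = mat 1"
    and Q: "Q = S ** (\<chi> i j. if i = j then of_real (r i) else 0) ** T" and r: "\<And>i. r i > 0"
    using strictly_positive_diagonalisable [OF assms] by blast
  let ?D = "\<lambda>f :: 'n \<Rightarrow> complex. \<chi> i j. if i = j then f i else 0"
  let ?P = "S ** ?D (\<lambda>i. 1 / of_real (r i)) ** T"
  have D: "?D f ** ?D g = mat 1" if "\<And>i. f i * g i = 1" for f g
    using that by (simp add: mat_eq_iff matrix_matrix_mult_nth mat_def
        if_distrib [of "\<lambda>x. x * _"] cong: if_cong)
  have mult: "S ** A ** T ** (S ** B ** T) = S ** (A ** B) ** T" for A B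
    by (metis ST(2) matrix_mul_assoc matrix_mul_lid)
  have "Q ** ?P = mat 1" "?P ** Q = mat 1"
    using r by (simp_all add: Q mult D ST less_imp_neq [symmetric])
  moreover have "transpose (map_matrix cnj Q) = Q"
    using assms by (simp add: strictly_positive_def)
  ultimately have "eigenbasis Q ?P S T (\<lambda>i. of_real (r i))"
  proof (intro eigenbasis.intro hermitian_invertible.intro eigenbasis_axioms.intro)
    show "complex_of_real (r i) \<noteq> 0" for i
      using r [of i] by simp
    show "complex_of_real (r i) = of_real (r j)"
      if "(complex_of_real (r i))\<^sup>2 = (of_real (r j))\<^sup>2" for i j
    proof -
      have "(r i)\<^sup>2 = (r j)\<^sup>2"
        using that by (simp flip: of_real_power)
      then show ?thesis
        using r [of i] r [of j] by (simp add: power2_eq_iff_nonneg)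
    qed
  qed (use ST Q in auto)
  then show ?thesis
    by blast
qed


section \<open>The isomorphism\<close>

text \<open>The first isomorphism theorem for the vector spaces represented by \<^typ>\<open>(complex, 'a) module\<close>
  records; for the additive groups it is the library theorem on factor groups.\<close>

lemma vs_isomorphic_quot_module:
  fixes V :: "(complex, 'a) module" and W :: "(complex, 'b) module"
  assumes V: "group (add_monoid V)" and W: "group (add_monoid W)"
    and closed: "\<And>a x. x \<in> carrier V \<Longrightarrow> a \<odot>\<^bsub>V\<^esub> x \<in> carrier V"
    and \<Phi>_add: "\<And>x y. x \<in> carrier V \<Longrightarrow> y \<in> carrier V \<Longrightarrow> \<Phi> (x \<oplus>\<^bsub>V\<^esub> y) = \<Phi> x \<oplus>\<^bsub>W\<^esub> \<Phi> y"
    and \<Phi>_smult: "\<And>a x. x \<in> carrier V \<Longrightarrow> \<Phi> (a \<odot>\<^bsub>V\<^esub> x) = a \<odot>\<^bsub>W\<^esub> \<Phi> x"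
    and onto: "\<Phi> ` carrier V = carrier W"
    and N: "N = {x \<in> carrier V. \<Phi> x = \<zero>\<^bsub>W\<^esub>}"
  shows "vs_isomorphic (quot_module V N) W"
proof -
  interpret group_hom "add_monoid V" "add_monoid W" \<Phi>
    using V W onto \<Phi>_add by (auto intro!: group_hom.intro group_hom_axioms.intro homI)
  have ker: "kernel (add_monoid V) (add_monoid W) \<Phi> = N"
    by (simp add: kernel_def N)
  have "iso (add_monoid (quot_module V N)) (add_monoid W) = iso (add_monoid V Mod N) (add_monoid W)"
    by (simp add: iso_def hom_def quot_module_def ring.defs module.defs FactRing_def FactGroup_def
        A_RCOSETS_def set_add_def)
  then have iso: "(\<lambda>X. the_elem (\<Phi> ` X)) \<in> iso (add_monoid (quot_module V N)) (add_monoid W)"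
    using FactGroup_iso_set onto by (simp add: ker)
  have coset: "\<Phi> ` (N +>\<^bsub>V\<^esub> x) = {\<Phi> x}" "N +>\<^bsub>V\<^esub> x \<subseteq> carrier V" "N +>\<^bsub>V\<^esub> x \<noteq> {}"
    if x: "x \<in> carrier V" for x
  proof -
    have z: "\<zero>\<^bsub>V\<^esub> \<in> N" "N \<subseteq> carrier V"
      using G.one_closed hom_one by (auto simp: N)
    have co: "N +>\<^bsub>V\<^esub> x = (\<lambda>h. h \<oplus>\<^bsub>V\<^esub> x) ` N"
      by (auto simp: a_r_coset_def r_coset_def)
    show "N +>\<^bsub>V\<^esub> x \<noteq> {}" "N +>\<^bsub>V\<^esub> x \<subseteq> carrier V"
      using z x G.m_closed by (auto simp: co)
    have "\<Phi> x \<in> carrier W"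
      using x onto by blast
    then have "\<Phi> (h \<oplus>\<^bsub>V\<^esub> x) = \<Phi> x" if "h \<in> N" for h
      using that x H.l_one [of "\<Phi> x"] \<Phi>_add [of h x] by (simp add: N)
    then have "(\<lambda>h. \<Phi> (h \<oplus>\<^bsub>V\<^esub> x)) ` N = (\<lambda>h. \<Phi> x) ` N"
      by (intro image_cong refl)
    then show "\<Phi> ` (N +>\<^bsub>V\<^esub> x) = {\<Phi> x}"
      unfolding co image_image using z by auto
  qed
  have "the_elem (\<Phi> ` (a \<odot>\<^bsub>quot_module V N\<^esub> X)) = a \<odot>\<^bsub>W\<^esub> the_elem (\<Phi> ` X)"
    if "X \<in> carrier (quot_module V N)" for a X
  proof -
    have "X \<in> a_rcosets\<^bsub>V\<^esub> N"
      using that by (simp add: quot_module_def ring.defs module.defs FactRing_def)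
    then obtain x where x: "x \<in> carrier V" "X = N +>\<^bsub>V\<^esub> x"
      unfolding A_RCOSETS_def' by blast
    have "\<Phi> ` (a \<odot>\<^bsub>quot_module V N\<^esub> X) = (\<Union>y\<in>X. \<Phi> ` (N +>\<^bsub>V\<^esub> (a \<odot>\<^bsub>V\<^esub> y)))"
      by (simp add: quot_module_def ring.defs module.defs image_UN)
    also have "\<dots> = (\<Union>y\<in>X. {a \<odot>\<^bsub>W\<^esub> \<Phi> y})"
    proof (rule SUP_cong [OF refl])
      fix y
      assume "y \<in> X"
      then have "y \<in> carrier V"
        using coset(2) [OF x(1)] x(2) by blast
      then show "\<Phi> ` (N +>\<^bsub>V\<^esub> (a \<odot>\<^bsub>V\<^esub> y)) = {a \<odot>\<^bsub>W\<^esub> \<Phi> y}"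
        using coset(1) [OF closed] \<Phi>_smult by simp
    qed
    also have "\<dots> = (\<lambda>w. a \<odot>\<^bsub>W\<^esub> w) ` \<Phi> ` X"
      by blast
    finally show ?thesis
      using coset(1) [OF x(1)] x(2) by simp
  qed
  then show ?thesis
    unfolding vs_isomorphic_def by (intro bexI [OF _ iso] allI ballI)
qed

context eigenbasis
begin

text \<open>The choice of the primitive does not matter, since two of them differ by a derivation
  (\<open>obstruction_class_eq\<close>).\<close>

definition obstruction_class ::
    "('n free_star_alg set \<Rightarrow> 'n free_star_alg set \<Rightarrow> complex) \<Rightarrow> complex^'n^'n" where
  "obstruction_class c = commutant_part (obstruction (SOME \<psi>. primitive (pullback c) \<psi>))"

lemma obstruction_class_eq:
  assumes \<psi>: "primitive (pullback c) \<psi>"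
  shows "obstruction_class c = commutant_part (obstruction \<psi>)"
proof -
  define \<psi>' where "\<psi>' = (SOME \<psi>. primitive (pullback c) \<psi>)"
  have "primitive (pullback c) \<psi>'"
    unfolding \<psi>'_def using \<psi> by (rule someI [of "primitive (pullback c)"])
  then have d: "derivation (\<lambda>x. \<psi>' x - \<psi> x)"
    using primitive_diff [OF _ \<psi>, of "pullback c" \<psi>'] by simp
  have "obstruction \<psi>' = obstruction (\<lambda>x. \<psi>' x - \<psi> x) + obstruction \<psi>"
    by (simp add: obstruction_diff)
  then have "commutant_part (obstruction \<psi>') = commutant_part (obstruction \<psi>)"
    by (simp add: commutant_part_add obstruction_derivation [OF d refl refl] commutant_part_conj)
  then show ?thesis
    by (simp add: obstruction_class_def \<psi>'_def)
qed

lemma pullback_add: "pullback (\<lambda>x y. c x y + c' x y) = (\<lambda>x y. pullback c x y + pullback c' x y)"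
  by (simp add: fun_eq_iff pullback_def)

lemma pullback_scale: "pullback (\<lambda>x y. a * c x y) = (\<lambda>x y. a * pullback c x y)"
  by (simp add: fun_eq_iff pullback_def)

lemma Z2_add: "c \<in> Z2 \<Longrightarrow> c' \<in> Z2 \<Longrightarrow> (\<lambda>x y. c x y + c' x y) \<in> Z2"
  by (simp add: Z2_iff pullback_add free_cocycles_add)

lemma Z2_scale: "c \<in> Z2 \<Longrightarrow> (\<lambda>x y. a * c x y) \<in> Z2"
  by (simp add: Z2_iff pullback_scale free_cocycles_scale)

lemma obstruction_class_add:
  assumes "c \<in> Z2" "c' \<in> Z2"
  shows "obstruction_class (\<lambda>x y. c x y + c' x y) = obstruction_class c + obstruction_class c'"
proof -
  obtain \<psi> \<psi>' where \<psi>: "primitive (pullback c) \<psi>" "primitive (pullback c') \<psi>'"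
    using primitive_pullback_exists assms by blast
  then have "primitive (pullback (\<lambda>x y. c x y + c' x y)) (\<lambda>x. \<psi> x + \<psi>' x)"
    by (simp add: pullback_add primitive_add)
  then show ?thesis
    using \<psi> by (simp add: obstruction_class_eq obstruction_add commutant_part_add)
qed

lemma obstruction_class_scale:
  assumes "c \<in> Z2"
  shows "obstruction_class (\<lambda>x y. a * c x y) = map_matrix ((*) a) (obstruction_class c)"
proof -
  obtain \<psi> where \<psi>: "primitive (pullback c) \<psi>"
    using primitive_pullback_exists assms by blast
  then have "primitive (pullback (\<lambda>x y. a * c x y)) (\<lambda>x. a * \<psi> x)"
    by (simp add: pullback_scale primitive_scale)
  then show ?thesis
    using \<psi> by (simp add: obstruction_class_eq obstruction_scale commutant_part_scale)
qed

lemma carrier_sl_Q: "carrier (sl_Q Q) = {A. A ** Q = Q ** A \<and> trace (A ** Q) = 0 \<and> trace (A ** P) = 0}"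
  by (simp add: sl_Q_def matrix_inv_eq)

lemma obstruction_class_onto: "obstruction_class ` Z2 = carrier (sl_Q Q)"
proof (intro equalityI image_subsetI subsetI)
  fix c
  assume c: "c \<in> Z2"
  obtain \<psi> where \<psi>: "primitive (pullback c) \<psi>"
    using primitive_pullback_exists [OF c] by blast
  then have "balanced \<psi>"
    by (rule primitive_pullback_balanced [OF c])
  then show "obstruction_class c \<in> carrier (sl_Q Q)"
    unfolding carrier_sl_Q mem_Collect_eq obstruction_class_eq [OF \<psi>]
    by (intro conjI commutant_part_commutes) (simp_all only: trace_commutant_part trace_obstruction)
next
  fix A
  assume A: "A \<in> carrier (sl_Q Q)"
  then have "realisable A"
    unfolding carrier_sl_Q by (blast intro: realisable_traceless)
  then obtain f where f: "balanced f" "obstruction f = A"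
    unfolding realisable_def by blast
  have "obstruction_class (descend f) = A"
    using A by (simp add: obstruction_class_eq [OF descend_in_Z2(2) [OF f(1)]] f(2) carrier_sl_Q
        commutant_part_id)
  then show "A \<in> obstruction_class ` Z2"
    using descend_in_Z2(1) [OF f(1)] by blast
qed

lemma B2_subset_Z2:
  assumes "c \<in> B2"
  shows "c \<in> Z2"
proof -
  obtain g where g: "linear_fun (\<lambda>x. g (proj x))" and c: "c = hochschild_d1 (Au Q) Au_counit g"
    using assms by (auto simp: hochschild_coboundaries2_def lin_functional_Au)
  have pb: "pullback c = (\<lambda>x y. free_counit x * g (proj y) - g (proj (x * y)) + g (proj x) * free_counit y)"
    by (simp add: fun_eq_iff c pullback_def hochschild_d1_def Au_simps)
  have "linear_fun (pullback c x)" "linear_fun (\<lambda>x. pullback c x y)" for x y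
    unfolding pb using linear_fun_times_left [OF g] linear_fun_times_right [OF g]
    by (intro linear_fun_plus linear_fun_minusI linear_fun_cmult linear_fun_multc g linear_fun_free_counit; simp)+
  then have "pullback c \<in> free_cocycles"
    unfolding free_cocycles_iff by (auto simp: pb algebra_simps)
  then show ?thesis
    by (auto simp: Z2_iff) (auto simp: c hochschild_d1_def carrier_Au)
qed

text \<open>If the obstruction matrix of a primitive is \<open>X - Q X P\<close>, then the derivation with value
  \<open>X\<^sup>t\<close> on \<open>u\<close>, and with the value on \<open>v\<close> that matches the unitarity relation, agrees with the
  primitive on all relations. Their difference is a primitive that vanishes on \<open>I\<close>.\<close>

lemma obstruction_class_kernel: "B2 = {c \<in> Z2. obstruction_class c = 0}"
proof (intro equalityI subsetI)
  fix c
  assume "c \<in> B2"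
  have c: "c \<in> Z2"
    using \<open>c \<in> B2\<close> by (rule B2_subset_Z2)
  obtain \<psi> where \<psi>: "primitive (pullback c) \<psi>" and zero: "\<And>r. r \<in> I \<Longrightarrow> \<psi> r = 0"
    using B2_iff [OF c] \<open>c \<in> B2\<close> by blast
  have "map_matrix \<psi> R = 0" if "entries_in I R" for R :: "('n free_star_alg)^'n^'n"
    using that zero by (simp add: mat_eq_iff entries_in_def)
  then have "obstruction \<psi> = 0"
    by (simp add: obstruction_def rel_in_I transpose_zero)
  then show "c \<in> {c \<in> Z2. obstruction_class c = 0}"
    using c commutant_part_conj [of 0] by (simp add: obstruction_class_eq [OF \<psi>])
next
  fix c
  assume "c \<in> {c \<in> Z2. obstruction_class c = 0}"
  then have c: "c \<in> Z2" and zero: "obstruction_class c = 0"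
    by auto
  obtain \<psi> where \<psi>: "primitive (pullback c) \<psi>"
    using primitive_pullback_exists [OF c] by blast
  obtain X where X: "obstruction \<psi> = X - Q ** X ** P"
    using commutant_part_eq_0 zero by (auto simp: obstruction_class_eq [OF \<psi>])
  let ?B = "map_matrix \<psi> (rel_unitary :: ('n free_star_alg)^'n^'n)"
  obtain \<delta> where \<delta>: "derivation \<delta>" "map_matrix \<delta> u_mat = transpose X"
    "map_matrix \<delta> ubar_mat = transpose ?B - X"
    using derivation_exists by blast
  let ?f = "\<lambda>x. \<psi> x - \<delta> x"
  have f: "primitive (pullback c) ?f"
    using primitive_diff [OF \<psi> \<delta>(1)] by simp
  have diff: "map_matrix ?f M = map_matrix \<psi> M - map_matrix \<delta> M" for M :: "('n free_star_alg)^'n^'n"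
    by (simp add: mat_eq_iff)
  have "map_matrix ?f (rel_unitary :: ('n free_star_alg)^'n^'n) = 0"
    by (simp add: diff derivation_rel_unitary [OF \<delta>] transpose_diff)
  moreover have "map_matrix ?f (rel_twisted Q) = 0"
  proof -
    have "map_matrix \<psi> (rel_twisted Q) = X - Q ** X ** P + Q ** transpose ?B ** P"
      using X by (simp add: obstruction_def algebra_simps)
    then show ?thesis
      by (simp add: diff derivation_rel_twisted [OF \<delta>] matrix_diff_ldistrib matrix_diff_rdistrib)
  qed
  ultimately have "?f r = 0" if "r \<in> I" for r
    using balanced_eq_zero [OF primitive_pullback_balanced [OF c f]] that by blast
  then show "c \<in> B2"
    using B2_iff [OF c] f by blast
qed

theorem H2_UQ_isomorphic: "vs_isomorphic (H2_UQ Q) (sl_Q Q)"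
  unfolding H2_UQ_def hochschild_H2_def
proof (rule vs_isomorphic_quot_module [where \<Phi> = obstruction_class])
  let ?Z = "hochschild_Z2 (Au Q) Au_counit"
  have zero: "(\<lambda>x y. 0) \<in> Z2"
  proof -
    have "pullback (\<lambda>x y. 0) = (\<lambda>x y. 0)"
      by (simp add: fun_eq_iff pullback_def)
    then show ?thesis
      by (simp add: Z2_iff free_cocycles_iff linear_fun_const_0)
  qed
  show "group (add_monoid ?Z)"
  proof (rule groupI)
    show "\<exists>c'\<in>carrier (add_monoid ?Z). c' \<otimes>\<^bsub>add_monoid ?Z\<^esub> c = \<one>\<^bsub>add_monoid ?Z\<^esub>"
      if "c \<in> carrier (add_monoid ?Z)" for c
      using that Z2_scale [of c "- 1"]
      by (intro bexI [of _ "\<lambda>x y. - 1 * c x y"]) (simp_all add: hochschild_Z2_def)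
  qed (simp_all add: hochschild_Z2_def Z2_add zero add.assoc)
  have trace_zero: "trace (0 :: complex^'n^'n) = 0"
    by (simp add: trace_def)
  show "group (add_monoid (sl_Q Q))"
  proof (rule groupI)
    show "\<exists>B\<in>carrier (add_monoid (sl_Q Q)). B \<otimes>\<^bsub>add_monoid (sl_Q Q)\<^esub> A = \<one>\<^bsub>add_monoid (sl_Q Q)\<^esub>"
      if "A \<in> carrier (add_monoid (sl_Q Q))" for A
      using that
      by (intro bexI [of _ "- A"])
        (auto simp: sl_Q_def matrix_mult_lminus matrix_mult_rminus trace_uminus)
  qed (auto simp: sl_Q_def matrix_add_ldistrib matrix_add_rdistrib trace_add trace_zero add.assoc)
qed (simp_all add: hochschild_Z2_def sl_Q_def Z2_scale obstruction_class_add obstruction_class_scale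
      obstruction_class_kernel obstruction_class_onto [unfolded sl_Q_def, simplified])

end

theorem theorem4p14:
  fixes Q :: "complex^'n^'n::finite"
  assumes "strictly_positive Q"
    and "\<not> (\<exists>p q :: real. p > 0 \<and> q > 0 \<and> q \<noteq> 1 \<and>
           eigenvalues Q = {of_real p, of_real (p * q), of_real (p * q\<^sup>2)})"
  shows "vs_isomorphic (H2_UQ Q) (sl_Q Q)"
  using strictly_positive_eigenbasis [OF assms(1)] eigenbasis.H2_UQ_isomorphic by blast

end
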